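(* Let $\phi:\mathcal H\to\mathbb R\cup\{+\infty\}$ be a proper lower semicontinuous convex function with $\operatorname{argmin}\phi\neq\emptyset$, and let $\alpha>3$, $\beta>0$, $t_0>0$. Let $(x,y):[t_0,+\infty[\to\mathcal H\times\mathcal H$ be the global strong solution of the system $$\left\{\begin{array}{rcl}\dot x(t)+\beta\partial\phi(x(t))-\left(\frac1\beta-\frac{\alpha}{t}\right)x(t)+\frac1\beta y(t)&\ni&0\\[2mm] \dot y(t)-\left(\frac1\beta-\frac{\alpha}{t}+\frac{\alpha\beta}{t^2}\right)x(t)+\frac1\beta y(t)&=&0\end{array}\right.$$ with initial value $(x(t_0),y(t_0))=(x_0,y_0)\in\operatorname{dom}\phi\times\mathcal H$. Then, as $t\to+\infty$, $$\phi(x(t))-\min\phi=o\left(t^{-2}\right)\qquad\text{and}\qquad\|\dot x(t)+\beta\xi(t)\|=o\left(t^{-1}\right)\ \text{(for almost every }t),$$ where $\xi$ is as in the context.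
   Context: $\mathcal H$ is a real Hilbert space with norm $\|\cdot\|$; $\partial\phi$ is the convex subdifferential; $\operatorname{dom}\phi=\{x:\phi(x)<+\infty\}$ and $\operatorname{dom}(\partial\phi)=\{x:\partial\phi(x)\neq\emptyset\}$. Strong solution: $(x,y)$ is a global strong solution of the system if for every $T>t_0$ it is continuous on $[t_0,T]$, absolutely continuous on every compact subset of $]t_0,T]$, $x(t)\in\operatorname{dom}(\partial\phi)$ for almost every $t\in]t_0,T]$, and both relations of the system hold for almost every $t\in]t_0,T]$. For every initial datum in $\operatorname{dom}\phi\times\mathcal H$ there is a unique such solution; for it $x$ is absolutely continuous on $[t_0,T]$ for all $T>t_0$, and there is a function $\xi:[t_0,+\infty[\to\mathcal H$ with $\xi(t)\in\partial\phi(x(t))$ for all $t>t_0$, $\dot x(t)+\beta\xi(t)-\left(\frac1\beta-\frac{\alpha}{t}\right)x(t)+\frac1\beta y(t)=0$ for almost every $t>t_0$, and $\xi\in L^2(t_0,T;\mathcal H)$ for all $T>t_0$ ($\xi$ is determined almost everywhere). *)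

theory Defs
  imports "HOL-Analysis.Analysis" "HOL-Library.Landau_Symbols"
begin

section \<open>Convex analysis for extended-real-valued functions\<close>

definition proper :: "('a \<Rightarrow> ereal) \<Rightarrow> bool" where
  "proper \<phi> \<longleftrightarrow> (\<forall>x. \<phi> x \<noteq> -\<infinity>) \<and> (\<exists>x. \<phi> x \<noteq> \<infinity>)"

definition lower_semicontinuous :: "('a::topological_space \<Rightarrow> ereal) \<Rightarrow> bool" where
  "lower_semicontinuous \<phi> \<longleftrightarrow> (\<forall>x. \<phi> x \<le> Liminf (at x) \<phi>)"

text \<open>The library's \<open>convex_on\<close> covers real-valued functions only. The definition below is meant
  for functions that avoid the value \<open>-\<infinity>\<close>, so that no sum \<open>\<infinity> + (-\<infinity>)\<close> occurs on the right-hand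
  side.\<close>

definition ereal_convex :: "('a::real_vector \<Rightarrow> ereal) \<Rightarrow> bool" where
  "ereal_convex \<phi> \<longleftrightarrow> (\<forall>x y. \<forall>u\<in>{0<..<1::real}.
     \<phi> ((1 - u) *\<^sub>R x + u *\<^sub>R y) \<le> ereal (1 - u) * \<phi> x + ereal u * \<phi> y)"

definition edom :: "('a \<Rightarrow> ereal) \<Rightarrow> 'a set" where
  "edom \<phi> = {x. \<phi> x < \<infinity>}"

text \<open>For proper \<open>\<phi>\<close> this set is empty at every point outside \<open>edom \<phi>\<close>.\<close>

definition subdifferential :: "('a::real_inner \<Rightarrow> ereal) \<Rightarrow> 'a \<Rightarrow> 'a set" where
  "subdifferential \<phi> x = {g. \<forall>z. \<phi> x + ereal (g \<bullet> (z - x)) \<le> \<phi> z}"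

definition dom_subdifferential :: "('a::real_inner \<Rightarrow> ereal) \<Rightarrow> 'a set" where
  "dom_subdifferential \<phi> = {x. subdifferential \<phi> x \<noteq> {}}"

definition argmin :: "('a \<Rightarrow> ereal) \<Rightarrow> 'a set" where
  "argmin \<phi> = {x. is_arg_min \<phi> (\<lambda>_. True) x}"

text \<open>The infimum is the minimum whenever \<open>argmin \<phi>\<close> is nonempty.\<close>

definition min_value :: "('a \<Rightarrow> ereal) \<Rightarrow> ereal" where
  "min_value \<phi> = (INF z. \<phi> z)"


section \<open>Absolutely continuous and square integrable functions of a real variable\<close>

text \<open>The \<open>n\<close> intervals \<open>[a i, b i]\<close> have endpoints in \<open>S\<close> and pairwise disjoint interiors.\<close>

definition abs_continuous_on :: "real set \<Rightarrow> (real \<Rightarrow> 'a::real_normed_vector) \<Rightarrow> bool" where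
  "abs_continuous_on S f \<longleftrightarrow>
     (\<forall>\<epsilon>>0. \<exists>\<delta>>0. \<forall>(n::nat) (a::nat \<Rightarrow> real) (b::nat \<Rightarrow> real).
        (\<forall>i<n. a i \<in> S \<and> b i \<in> S \<and> a i \<le> b i) \<longrightarrow>
        disjoint_family_on (\<lambda>i. {a i<..<b i}) {..<n} \<longrightarrow>
        (\<Sum>i<n. b i - a i) < \<delta> \<longrightarrow>
        (\<Sum>i<n. norm (f (b i) - f (a i))) < \<epsilon>)"

text \<open>The library's Bochner integral requires a second countable range. A Hilbert space need not be
  separable, so strong measurability is stated directly.\<close>

definition strongly_measurable :: "'b measure \<Rightarrow> ('b \<Rightarrow> 'a::real_normed_vector) \<Rightarrow> bool" where
  "strongly_measurable M f \<longleftrightarrow>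
     (\<exists>s::nat \<Rightarrow> 'b \<Rightarrow> 'a. (\<forall>n. simple_function M (s n)) \<and>
        (AE t in M. (\<lambda>n. s n t) \<longlonglongrightarrow> f t))"

definition square_integrable :: "'b measure \<Rightarrow> ('b \<Rightarrow> 'a::real_normed_vector) \<Rightarrow> bool" where
  "square_integrable M f \<longleftrightarrow>
     strongly_measurable M f \<and> integrable M (\<lambda>t. (norm (f t))\<^sup>2)"

text \<open>Convergence to infinity for almost every \<open>t\<close>: a property holds eventually along this filter
  iff there is \<open>T\<close> such that it holds for almost every \<open>t \<ge> T\<close>.\<close>

definition ae_at_top :: "real filter" where
  "ae_at_top = inf at_top (ae_filter lebesgue)"

lemma eventually_ae_at_top:
  "eventually P ae_at_top \<longleftrightarrow> (\<exists>T. AE t in lebesgue. t \<ge> T \<longrightarrow> P t)"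
proof
  assume "eventually P ae_at_top"
  then obtain Q R where Q: "eventually Q at_top" and R: "AE t in lebesgue. R t"
    and QR: "\<And>t. Q t \<and> R t \<Longrightarrow> P t"
    unfolding ae_at_top_def eventually_inf by blast
  from Q obtain T where "\<And>t. t \<ge> T \<Longrightarrow> Q t"
    unfolding eventually_at_top_linorder by blast
  then have "AE t in lebesgue. t \<ge> T \<longrightarrow> P t"
    using QR by (intro eventually_mono[OF R]) blast
  then show "\<exists>T. AE t in lebesgue. t \<ge> T \<longrightarrow> P t" ..
next
  assume "\<exists>T. AE t in lebesgue. t \<ge> T \<longrightarrow> P t"
  then obtain T where T: "AE t in lebesgue. t \<ge> T \<longrightarrow> P t" ..
  then show "eventually P ae_at_top"
    unfolding ae_at_top_def eventually_inf
    using eventually_ge_at_top[of T] by blast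
qed


section \<open>The first-order system\<close>

text \<open>The functions \<open>x\<close> and \<open>y\<close> are total; only their values on \<open>[t0, \<infinity>[\<close> matter.\<close>

definition global_strong_solution ::
  "('a::real_inner \<Rightarrow> ereal) \<Rightarrow> real \<Rightarrow> real \<Rightarrow> real \<Rightarrow> (real \<Rightarrow> 'a) \<Rightarrow> (real \<Rightarrow> 'a) \<Rightarrow> bool" where
  "global_strong_solution \<phi> \<alpha> \<beta> t0 x y \<longleftrightarrow> (\<forall>T>t0.
     continuous_on {t0..T} x \<and> continuous_on {t0..T} y \<and>
     (\<forall>K. compact K \<and> K \<subseteq> {t0<..T} \<longrightarrow> abs_continuous_on K x \<and> abs_continuous_on K y) \<and>
     (AE t in lebesgue. t \<in> {t0<..T} \<longrightarrow> x t \<in> dom_subdifferential \<phi>) \<and>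
     (AE t in lebesgue. t \<in> {t0<..T} \<longrightarrow>
        (\<exists>x' g. (x has_vector_derivative x') (at t) \<and> g \<in> subdifferential \<phi> (x t) \<and>
           x' + \<beta> *\<^sub>R g - (1 / \<beta> - \<alpha> / t) *\<^sub>R x t + (1 / \<beta>) *\<^sub>R y t = 0)) \<and>
     (AE t in lebesgue. t \<in> {t0<..T} \<longrightarrow>
        (\<exists>y'. (y has_vector_derivative y') (at t) \<and>
           y' - (1 / \<beta> - \<alpha> / t + \<alpha> * \<beta> / t\<^sup>2) *\<^sub>R x t + (1 / \<beta>) *\<^sub>R y t = 0)))"

definition subgradient_selection ::
  "('a::real_inner \<Rightarrow> ereal) \<Rightarrow> real \<Rightarrow> real \<Rightarrow> real \<Rightarrow> (real \<Rightarrow> 'a) \<Rightarrow> (real \<Rightarrow> 'a) \<Rightarrow> (real \<Rightarrow> 'a) \<Rightarrow> bool"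
where
  "subgradient_selection \<phi> \<alpha> \<beta> t0 x y \<xi> \<longleftrightarrow>
     (\<forall>t>t0. \<xi> t \<in> subdifferential \<phi> (x t)) \<and>
     (AE t in lebesgue. t > t0 \<longrightarrow>
        (\<exists>x'. (x has_vector_derivative x') (at t) \<and>
           x' + \<beta> *\<^sub>R \<xi> t - (1 / \<beta> - \<alpha> / t) *\<^sub>R x t + (1 / \<beta>) *\<^sub>R y t = 0)) \<and>
     (\<forall>T>t0. square_integrable (lebesgue_on {t0<..<T}) \<xi>)"

end

theory Submission
  imports Defs
begin

text \<open>With \<open>u = (1/\<beta> - \<alpha>/t) x - y/\<beta>\<close> the system reads \<open>x' = u - \<beta> \<xi>\<close>, \<open>u' = - (\<alpha>/t) x' - \<xi>\<close> with
  \<open>\<xi> \<in> \<partial>\<phi>(x)\<close>. Write \<open>f = \<phi>(x) - min \<phi>\<close>. For \<open>z \<in> argmin \<phi>\<close> consider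
  \<open>E\<^sub>\<mu> = t (t - \<beta>(\<alpha> - \<mu>)) f + |\<mu>(x - z) + t u|\<^sup>2 / 2 + \<mu>(\<alpha> - 1 - \<mu>) |x - z|\<^sup>2 / 2\<close>. Because \<open>\<alpha> > 3\<close>, some
  \<open>\<mu> = 2 + \<delta>\<close> with \<open>\<delta> > 0\<close> gives \<open>E\<^sub>\<mu>' \<le> - (\<delta>/2) t (f + |u|\<^sup>2)\<close> eventually, whereas \<open>E\<^sub>0' \<le> 2 t f\<close>. Hence
  \<open>E\<^sub>\<mu>\<close> and \<open>E\<^sub>0 + (4/\<delta>) E\<^sub>\<mu>\<close> decrease and \<open>E\<^sub>0\<close> converges; a positive limit would force
  \<open>E\<^sub>\<mu>' \<le> - c/t\<close>, which is impossible since \<open>E\<^sub>\<mu> \<ge> 0\<close>. So \<open>E\<^sub>0 \<rightarrow> 0\<close>, which is both claims at once.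

  Away from \<open>t0\<close> the solution \<open>x\<close> is Lipschitz (compare it with its translates), so the
  subgradients are bounded and \<open>\<phi> \<circ> x\<close> is finite and Lipschitz. The chain rule for \<open>\<phi> \<circ> x\<close> is
  replaced by the one-sided bound \<open>\<phi>(x s) \<ge> \<phi>(x t) + \<xi> \<bullet> (x s - x t)\<close>: an absolutely continuous
  function does not increase if it is touched from below, on the left of almost every point, by a
  function with nonpositive derivative.\<close>

section \<open>Absolutely continuous functions\<close>

text \<open>Absolute continuity only sees increments, so a bound on the increments of
  \<open>h\<close> by those of \<open>f\<close> and \<open>g\<close> transfers it. Sums, pairs and
  products below all reduce to such a bound.\<close>

lemma abs_continuous_on_combine:
  fixes f :: "real \<Rightarrow> 'a::real_normed_vector" and g :: "real \<Rightarrow> 'b::real_normed_vector"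
    and h :: "real \<Rightarrow> 'c::real_normed_vector"
  assumes f: "abs_continuous_on S f" and g: "abs_continuous_on S g"
    and h: "\<And>s t. s \<in> S \<Longrightarrow> t \<in> S \<Longrightarrow> norm (h t - h s) \<le> A * norm (f t - f s) + B * norm (g t - g s)"
  shows "abs_continuous_on S h"
  unfolding abs_continuous_on_def
proof (intro allI impI)
  fix \<epsilon> :: real assume "\<epsilon> > 0"
  \<comment> \<open>The extra 1 keeps the denominator positive and makes the final comparison with
    \<open>\<epsilon>\<close> strict.\<close>
  define \<eta> where "\<eta> = \<epsilon> / (\<bar>A\<bar> + \<bar>B\<bar> + 1)"
  have "\<eta> > 0" using \<open>\<epsilon> > 0\<close> by (simp add: \<eta>_def)
  obtain \<delta>1 where \<delta>1: "\<delta>1 > 0" "\<And>(n::nat) a b. \<forall>i<n. a i \<in> S \<and> b i \<in> S \<and> a i \<le> b i \<Longrightarrow>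
      disjoint_family_on (\<lambda>i. {a i<..<b i}) {..<n} \<Longrightarrow> (\<Sum>i<n. b i - a i) < \<delta>1 \<Longrightarrow>
      (\<Sum>i<n. norm (f (b i) - f (a i))) < \<eta>"
    using f \<open>\<eta> > 0\<close> unfolding abs_continuous_on_def by meson
  obtain \<delta>2 where \<delta>2: "\<delta>2 > 0" "\<And>(n::nat) a b. \<forall>i<n. a i \<in> S \<and> b i \<in> S \<and> a i \<le> b i \<Longrightarrow>
      disjoint_family_on (\<lambda>i. {a i<..<b i}) {..<n} \<Longrightarrow> (\<Sum>i<n. b i - a i) < \<delta>2 \<Longrightarrow>
      (\<Sum>i<n. norm (g (b i) - g (a i))) < \<eta>"
    using g \<open>\<eta> > 0\<close> unfolding abs_continuous_on_def by meson
  show "\<exists>\<delta>>0. \<forall>(n::nat) a b. (\<forall>i<n. a i \<in> S \<and> b i \<in> S \<and> a i \<le> b i) \<longrightarrow>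
      disjoint_family_on (\<lambda>i. {a i<..<b i}) {..<n} \<longrightarrow> (\<Sum>i<n. b i - a i) < \<delta> \<longrightarrow>
      (\<Sum>i<n. norm (h (b i) - h (a i))) < \<epsilon>"
  proof (intro exI conjI allI impI)
    show "min \<delta>1 \<delta>2 > 0" using \<delta>1 \<delta>2 by simp
    fix n :: nat and a b :: "nat \<Rightarrow> real"
    assume I: "\<forall>i<n. a i \<in> S \<and> b i \<in> S \<and> a i \<le> b i"
      and D: "disjoint_family_on (\<lambda>i. {a i<..<b i}) {..<n}"
      and L: "(\<Sum>i<n. b i - a i) < min \<delta>1 \<delta>2"
    let ?F = "\<Sum>i<n. norm (f (b i) - f (a i))" and ?G = "\<Sum>i<n. norm (g (b i) - g (a i))"
    have F: "?F < \<eta>" and G: "?G < \<eta>" using \<delta>1(2)[OF I D] \<delta>2(2)[OF I D] L by auto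
    have "0 \<le> ?F" "0 \<le> ?G" by (auto intro: sum_nonneg)
    have "(\<Sum>i<n. norm (h (b i) - h (a i)))
        \<le> (\<Sum>i<n. A * norm (f (b i) - f (a i)) + B * norm (g (b i) - g (a i)))"
      using I h by (intro sum_mono) auto
    also have "\<dots> = A * ?F + B * ?G" by (simp add: sum.distrib sum_distrib_left)
    also have "\<dots> \<le> \<bar>A\<bar> * \<eta> + \<bar>B\<bar> * \<eta>"
      using F G \<open>0 \<le> ?F\<close> \<open>0 \<le> ?G\<close> by (intro add_mono mult_mono) auto
    also have "\<dots> < (\<bar>A\<bar> + \<bar>B\<bar> + 1) * \<eta>" using \<open>\<eta> > 0\<close> by (simp add: algebra_simps)
    also have "\<dots> = \<epsilon>" unfolding \<eta>_def by (simp add: field_simps)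
    finally show "(\<Sum>i<n. norm (h (b i) - h (a i))) < \<epsilon>" .
  qed
qed

lemma abs_continuous_on_ident: "abs_continuous_on S (\<lambda>t::real. t)"
  unfolding abs_continuous_on_def
proof (intro allI impI exI conjI)
  fix \<epsilon> :: real and n :: nat and a b :: "nat \<Rightarrow> real"
  assume I: "\<forall>i<n. a i \<in> S \<and> b i \<in> S \<and> a i \<le> b i" and L: "(\<Sum>i<n. b i - a i) < \<epsilon>"
  have "(\<Sum>i<n. norm (b i - a i)) = (\<Sum>i<n. b i - a i)" using I by (intro sum.cong) auto
  then show "(\<Sum>i<n. norm (b i - a i)) < \<epsilon>" using L by simp
qed

lemma abs_continuous_on_lipschitz:
  fixes f :: "real \<Rightarrow> 'a::real_normed_vector"
  assumes "L-lipschitz_on S f"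
  shows "abs_continuous_on S f"
  by (rule abs_continuous_on_combine[OF abs_continuous_on_ident abs_continuous_on_ident, of _ _ L 0])
    (use lipschitz_onD[OF assms] in \<open>auto simp: dist_norm\<close>)

lemma abs_continuous_on_const: "abs_continuous_on S (\<lambda>t. c)"
  by (rule abs_continuous_on_combine[OF abs_continuous_on_ident abs_continuous_on_ident, of _ _ 0 0]) auto

lemma abs_continuous_on_add:
  assumes "abs_continuous_on S f" "abs_continuous_on S g"
  shows "abs_continuous_on S (\<lambda>t. f t + g t)"
  by (rule abs_continuous_on_combine[OF assms, of _ 1 1]) (simp add: add_diff_add norm_triangle_ineq)

lemma abs_continuous_on_diff:
  assumes "abs_continuous_on S f" "abs_continuous_on S g"
  shows "abs_continuous_on S (\<lambda>t. f t - g t)"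
proof (rule abs_continuous_on_combine[OF assms, of _ 1 1])
  fix s t
  have "f t - g t - (f s - g s) = (f t - f s) - (g t - g s)" by simp
  then show "norm (f t - g t - (f s - g s)) \<le> 1 * norm (f t - f s) + 1 * norm (g t - g s)"
    by (simp only: mult_1_left norm_triangle_ineq4)
qed

lemma abs_continuous_on_Pair:
  assumes "abs_continuous_on S f" "abs_continuous_on S g"
  shows "abs_continuous_on S (\<lambda>t. (f t, g t))"
  by (rule abs_continuous_on_combine[OF assms, of _ 1 1])
    (use norm_Pair_le in auto)

lemma abs_continuous_on_imp_continuous_on:
  fixes f :: "real \<Rightarrow> 'a::real_normed_vector"
  assumes "abs_continuous_on S f"
  shows "continuous_on S f"
  unfolding continuous_on_iff
proof (intro ballI allI impI)
  fix t e :: real assume t: "t \<in> S" and "e > 0"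
  then obtain d where d: "d > 0" "\<And>(n::nat) a b. \<forall>i<n. a i \<in> S \<and> b i \<in> S \<and> a i \<le> b i \<Longrightarrow>
      disjoint_family_on (\<lambda>i. {a i<..<b i}) {..<n} \<Longrightarrow> (\<Sum>i<n. b i - a i) < d \<Longrightarrow>
      (\<Sum>i<n. norm (f (b i) - f (a i))) < e"
    using assms unfolding abs_continuous_on_def by meson
  \<comment> \<open>A family of one interval suffices; both orientations are supplied since
    \<open>s\<close> may lie on either side of \<open>t\<close>.\<close>
  have "dist (f s) (f t) < e" if s: "s \<in> S" "dist s t < d" for s
    using d(2)[of "Suc 0" "\<lambda>_. s" "\<lambda>_. t"] d(2)[of "Suc 0" "\<lambda>_. t" "\<lambda>_. s"] s t
    by (cases "s \<le> t") (simp_all add: disjoint_family_on_def dist_norm norm_minus_commute)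
  then show "\<exists>d>0. \<forall>s\<in>S. dist s t < d \<longrightarrow> dist (f s) (f t) < e" using d(1) by blast
qed

text \<open>On a compact set both factors are bounded, so the increment of the product, split with
  one factor frozen at a time, is dominated by the increments of the factors.\<close>

lemma (in bounded_bilinear) abs_continuous_on:
  assumes f: "abs_continuous_on S f" and g: "abs_continuous_on S g" and "compact S"
  shows "abs_continuous_on S (\<lambda>t. prod (f t) (g t))"
proof -
  have "bounded (f ` S)" "bounded (g ` S)"
    using assms by (auto intro!: compact_imp_bounded compact_continuous_image
        abs_continuous_on_imp_continuous_on)
  then obtain A B where A: "\<And>t. t \<in> S \<Longrightarrow> norm (f t) \<le> A" and B: "\<And>t. t \<in> S \<Longrightarrow> norm (g t) \<le> B"
    unfolding bounded_iff by blast
  obtain K where K: "K \<ge> 0" "\<And>a b. norm (prod a b) \<le> norm a * norm b * K"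
    using nonneg_bounded by blast
  show ?thesis
  proof (rule abs_continuous_on_combine[OF f g, of _ "B * K" "A * K"])
    fix s t assume st: "s \<in> S" "t \<in> S"
    have "prod (f t) (g t) - prod (f s) (g s) = prod (f t - f s) (g t) + prod (f s) (g t - g s)"
      by (simp add: diff_left diff_right)
    then have "norm (prod (f t) (g t) - prod (f s) (g s))
        \<le> norm (prod (f t - f s) (g t)) + norm (prod (f s) (g t - g s))"
      by (simp add: norm_triangle_ineq)
    also have "\<dots> \<le> norm (f t - f s) * norm (g t) * K + norm (f s) * norm (g t - g s) * K"
      using K by (intro add_mono)
    also have "\<dots> \<le> norm (f t - f s) * B * K + A * norm (g t - g s) * K"
      using A[OF st(1)] B[OF st(2)] K(1)
      by (intro add_mono mult_right_mono mult_left_mono) auto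
    finally show "norm (prod (f t) (g t) - prod (f s) (g s))
        \<le> B * K * norm (f t - f s) + A * K * norm (g t - g s)" by (simp add: mult_ac)
  qed
qed

lemmas abs_continuous_on_mult = bounded_bilinear.abs_continuous_on[OF bounded_bilinear_mult]
lemmas abs_continuous_on_scaleR = bounded_bilinear.abs_continuous_on[OF bounded_bilinear_scaleR]
lemmas abs_continuous_on_inner = bounded_bilinear.abs_continuous_on[OF bounded_bilinear_inner]

lemma abs_continuous_on_norm_square:
  fixes f :: "real \<Rightarrow> 'a::real_inner"
  assumes "abs_continuous_on S f" "compact S"
  shows "abs_continuous_on S (\<lambda>t. (norm (f t))\<^sup>2)"
  using abs_continuous_on_inner[OF assms(1,1,2)] by (simp add: power2_norm_eq_inner)

text \<open>Serves to compare \<open>x\<close> with its translates in the Lipschitz estimate;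
  \<open>h = 0\<close> gives restriction to a subset.\<close>

lemma abs_continuous_on_shift:
  assumes "abs_continuous_on S f" "\<And>t. t \<in> T \<Longrightarrow> t + h \<in> S"
  shows "abs_continuous_on T (\<lambda>t. f (t + h))"
  unfolding abs_continuous_on_def
proof (intro allI impI)
  fix e :: real assume "e > 0"
  then obtain d where d: "d > 0" "\<And>(n::nat) a b. \<forall>i<n. a i \<in> S \<and> b i \<in> S \<and> a i \<le> b i \<Longrightarrow>
      disjoint_family_on (\<lambda>i. {a i<..<b i}) {..<n} \<Longrightarrow> (\<Sum>i<n. b i - a i) < d \<Longrightarrow>
      (\<Sum>i<n. norm (f (b i) - f (a i))) < e"
    using assms(1) unfolding abs_continuous_on_def by meson
  have "(\<Sum>i<n. norm (f (b i + h) - f (a i + h))) < e"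
    if I: "\<forall>i<n. a i \<in> T \<and> b i \<in> T \<and> a i \<le> b i" and D: "disjoint_family_on (\<lambda>i. {a i<..<b i}) {..<n}"
      and L: "(\<Sum>i<n. b i - a i) < d" for n :: nat and a b
  proof (rule d(2))
    show "disjoint_family_on (\<lambda>i. {a i + h<..<b i + h}) {..<n}"
    proof (unfold disjoint_family_on_def, intro ballI impI)
      fix i j assume "i \<in> {..<n}" "j \<in> {..<n}" "i \<noteq> j"
      then have "{a i<..<b i} \<inter> {a j<..<b j} = {}" using D by (auto simp: disjoint_family_on_def)
      then have "r - h \<notin> {a i<..<b i} \<inter> {a j<..<b j}" for r by simp
      then show "{a i + h<..<b i + h} \<inter> {a j + h<..<b j + h} = {}" by (fastforce simp: algebra_simps)
    qed
  qed (use I L assms(2) in auto)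
  then show "\<exists>\<delta>>0. \<forall>(n::nat) a b. (\<forall>i<n. a i \<in> T \<and> b i \<in> T \<and> a i \<le> b i) \<longrightarrow>
      disjoint_family_on (\<lambda>i. {a i<..<b i}) {..<n} \<longrightarrow> (\<Sum>i<n. b i - a i) < \<delta> \<longrightarrow>
      (\<Sum>i<n. norm (f (b i + h) - f (a i + h))) < e"
    using d(1) by blast
qed

lemma abs_continuous_on_subset:
  assumes "abs_continuous_on S f" "T \<subseteq> S"
  shows "abs_continuous_on T f"
  using abs_continuous_on_shift[OF assms(1), of T 0] assms(2) by auto

lemma C1_imp_lipschitz_on:
  fixes f :: "real \<Rightarrow> real"
  assumes "\<And>t. t \<in> {a..b} \<Longrightarrow> (f has_real_derivative f' t) (at t)" and "continuous_on {a..b} f'"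
  obtains L where "L-lipschitz_on {a..b} f"
proof -
  have "bounded (f' ` {a..b})" using assms(2) by (intro compact_imp_bounded compact_continuous_image) auto
  then obtain B where "\<And>t. t \<in> {a..b} \<Longrightarrow> norm (f' t) \<le> B" unfolding bounded_iff by blast
  \<comment> \<open>\<open>B\<close> may be negative when the interval is empty, whereas a Lipschitz
    constant has to be nonnegative.\<close>
  then have B: "\<And>t. t \<in> {a..b} \<Longrightarrow> norm (f' t) \<le> max 0 B" by (meson max.coboundedI2)
  have "(max 0 B)-lipschitz_on {a..b} f"
  proof (rule lipschitz_onI)
    fix s t assume "s \<in> {a..b}" "t \<in> {a..b}"
    then show "dist (f s) (f t) \<le> max 0 B * dist s t"
      using field_differentiable_bound[of "{a..b}" f f' "max 0 B" s t] assms(1) B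
      by (auto simp: dist_norm has_field_derivative_at_within)
  qed simp
  then show ?thesis by (rule that)
qed

lemma abs_continuous_on_C1:
  fixes f :: "real \<Rightarrow> real"
  assumes "\<And>t. t \<in> {a..b} \<Longrightarrow> (f has_real_derivative f' t) (at t)" and "continuous_on {a..b} f'"
  shows "abs_continuous_on {a..b} f"
  using C1_imp_lipschitz_on[OF assms] abs_continuous_on_lipschitz by metis

section \<open>Null sets of the real line\<close>

lemma AE_lebesgueE:
  assumes "AE t in lebesgue. P t"
  obtains N where "N \<in> null_sets lebesgue" "\<And>t. t \<notin> N \<Longrightarrow> P t"
  by (rule AE_E3[OF assms]) (simp add: that)

text \<open>Translates of null sets are null; this allows differentiation at \<open>s\<close> and at
  \<open>s + h\<close> simultaneously.\<close>

lemma AE_lebesgue_shift: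
  assumes "AE t in lebesgue. P (t::real)"
  shows "AE t in lebesgue. P (t + h)"
proof -
  obtain N where N: "N \<in> null_sets lebesgue" "\<And>t. t \<notin> N \<Longrightarrow> P t"
    by (rule AE_lebesgueE[OF assms]) (rule that)
  have "negligible ((+) (-h) ` N)"
    using N(1) by (intro negligible_translation) (simp add: negligible_iff_null_sets)
  moreover have "{t. \<not> P (t + h)} \<subseteq> (+) (-h) ` N" using N(2) by (force simp: image_iff)
  ultimately show ?thesis by (intro AE_I'[of "(+) (-h) ` N"]) (auto simp: negligible_iff_null_sets)
qed

lemma AE_lebesgue_obtain_in_interval:
  fixes a b :: real
  assumes "AE t in lebesgue. t \<in> {a<..<b} \<longrightarrow> P t" and "a < b"
  obtains t where "t \<in> {a<..<b}" "P t"
proof -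
  obtain N where N: "N \<in> null_sets lebesgue" "\<And>t. t \<notin> N \<Longrightarrow> t \<in> {a<..<b} \<longrightarrow> P t"
    by (rule AE_lebesgueE[OF assms(1)]) (rule that)
  have "\<not> negligible {a<..<b}" using \<open>a < b\<close>
    by (metis box_real(1) negligible_interval(2) greaterThanLessThan_empty_iff linorder_not_le)
  then have "\<not> {a<..<b} \<subseteq> N" using N(1) negligible_iff_null_sets negligible_subset by blast
  then show ?thesis using N(2) that by blast
qed

section \<open>Monotonicity through one-sided test functions\<close>

text \<open>A test function in the spirit of viscosity solutions: \<open>p\<close> touches
  \<open>h\<close> from below at \<open>t\<close>, so for \<open>a < t\<close> the upper limit of
  the difference quotients of \<open>h\<close> from the left is at most \<open>d\<close>, while
  \<open>h\<close> itself need not be differentiable there.\<close>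

definition left_support :: "real \<Rightarrow> (real \<Rightarrow> real) \<Rightarrow> real \<Rightarrow> real \<Rightarrow> bool" where
  "left_support a h t d \<longleftrightarrow>
     (\<exists>p. (p has_real_derivative d) (at t) \<and> p t = h t \<and> (\<forall>s\<in>{a..t}. p s \<le> h s))"

lemma left_support_antimono: "left_support a h t d \<Longrightarrow> a \<le> b \<Longrightarrow> left_support b h t d"
  unfolding left_support_def by fastforce

lemma left_support_derivative:
  "(h has_real_derivative d) (at t) \<Longrightarrow> left_support a h t d"
  unfolding left_support_def by blast

lemma left_support_add:
  assumes "left_support a h t d" "left_support a k t e"
  shows "left_support a (\<lambda>s. h s + k s) t (d + e)"
proof -
  obtain p q where "(p has_real_derivative d) (at t)" "p t = h t" "\<forall>s\<in>{a..t}. p s \<le> h s"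
    "(q has_real_derivative e) (at t)" "q t = k t" "\<forall>s\<in>{a..t}. q s \<le> k s"
    using assms unfolding left_support_def by blast
  then show ?thesis unfolding left_support_def
    by (intro exI[of _ "\<lambda>s. p s + q s"]) (auto intro: DERIV_add add_mono)
qed

lemma left_support_cmult:
  assumes "left_support a h t d" "0 \<le> c"
  shows "left_support a (\<lambda>s. c * h s) t (c * d)"
proof -
  obtain p where "(p has_real_derivative d) (at t)" "p t = h t" "\<forall>s\<in>{a..t}. p s \<le> h s"
    using assms unfolding left_support_def by blast
  then show ?thesis unfolding left_support_def using \<open>0 \<le> c\<close>
    by (intro exI[of _ "\<lambda>s. c * p s"]) (auto intro: DERIV_cmult mult_left_mono)
qed

text \<open>The exceptional null set is covered by an open set on which the variation of \<open>h\<close> is small;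
  the inequality is then propagated from \<open>b\<close> to the left, points of that open set being paid for
  by the variation \<open>M\<close>.\<close>

lemma abs_continuous_on_nonincreasing:
  fixes h :: "real \<Rightarrow> real"
  assumes "a \<le> b" and AC: "abs_continuous_on {a..b} h"
    and touch: "AE t in lebesgue. t \<in> {a<..<b} \<longrightarrow> (\<exists>d\<le>0. left_support a h t d)"
  shows "h b \<le> h a"
proof (rule field_le_epsilon)
  fix \<epsilon> :: real assume "\<epsilon> > 0"
  \<comment> \<open>The error budget is \<open>e\<close> per unit of length, plus one further
    \<open>e\<close> for the variation of \<open>h\<close> around the exceptional set.\<close>
  define e where "e = \<epsilon> / (b - a + 1)"
  have "e > 0" using \<open>\<epsilon> > 0\<close> \<open>a \<le> b\<close> by (simp add: e_def)
  have "e * (b - a) + e = e * (b - a + 1)" by (simp add: algebra_simps)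
  then have e: "e * (b - a) + e = \<epsilon>" using \<open>a \<le> b\<close> by (simp add: e_def)
  obtain N where N: "N \<in> null_sets lebesgue" "\<And>t. t \<notin> N \<Longrightarrow> t \<in> {a<..<b} \<longrightarrow> (\<exists>d\<le>0. left_support a h t d)"
    by (rule AE_lebesgueE[OF touch]) (rule that)
  obtain \<delta> where \<delta>: "\<delta> > 0" "\<And>(n::nat) l r. \<forall>i<n. l i \<in> {a..b} \<and> r i \<in> {a..b} \<and> l i \<le> r i \<Longrightarrow>
      disjoint_family_on (\<lambda>i. {l i<..<r i}) {..<n} \<Longrightarrow> (\<Sum>i<n. r i - l i) < \<delta> \<Longrightarrow>
      (\<Sum>i<n. norm (h (r i) - h (l i))) < e"
    using AC \<open>e > 0\<close> unfolding abs_continuous_on_def by meson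
  \<comment> \<open>The endpoint \<open>b\<close> is treated as exceptional because touching
    functions are only given in the open interval, while the propagation starts at
    \<open>b\<close>.\<close>
  have "insert b N \<in> null_sets lebesgue"
    using N(1) by (metis negligible_iff_null_sets negligible_insert)
  then obtain U where U: "open U" "insert b N \<subseteq> U" "emeasure lebesgue U < ennreal \<delta>"
  proof -
    assume *: "insert b N \<in> null_sets lebesgue"
      and that: "\<And>U. open U \<Longrightarrow> insert b N \<subseteq> U \<Longrightarrow> emeasure lebesgue U < ennreal \<delta> \<Longrightarrow> thesis"
    obtain U where U: "open U" "insert b N \<subseteq> U" "(U - insert b N) \<in> lmeasurable"
        "emeasure lebesgue (U - insert b N) < ennreal \<delta>"
      using sets_lebesgue_outer_open[of "insert b N" \<delta>] * \<delta>(1) by blast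
    have "emeasure lebesgue (U - insert b N) = emeasure lebesgue U"
      using * U(1) by (intro emeasure_Diff_null_set) auto
    then show thesis using U that by simp
  qed
  \<comment> \<open>\<open>M t\<close> is meant as the total variation of \<open>h\<close> on the
    part of \<open>U\<close> between \<open>t\<close> and \<open>b\<close>; since \<open>U\<close>
    has measure below \<open>\<delta>\<close>, it is at most \<open>e\<close> for
    \<open>a \<le> t\<close>.\<close>
  define A where "A t n l r \<longleftrightarrow> (\<forall>i<n. l i \<in> {t..b} \<and> r i \<in> {t..b} \<and> l i \<le> r i \<and> {l i<..<r i} \<subseteq> U) \<and>
      disjoint_family_on (\<lambda>i. {l i<..<r i}) {..<n}" for t and n :: nat and l r :: "nat \<Rightarrow> real"
  define C where "C t = {\<Sum>i<n. norm (h (r i) - h (l i)) | n l r. A t n l r}" for t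
  define M where "M t = Sup (C t)" for t
  have C_le: "v \<le> e" if v: "v \<in> C t" and "a \<le> t" for t v
  proof -
    obtain n l r where v: "v = (\<Sum>i<n. norm (h (r i) - h (l i)))" and A: "A t n l r"
      using v unfolding C_def by blast
    have D: "disjoint_family_on (\<lambda>i. {l i<..<r i}) {..<n}"
      and I: "\<And>i. i < n \<Longrightarrow> l i \<in> {t..b} \<and> r i \<in> {t..b} \<and> l i \<le> r i \<and> {l i<..<r i} \<subseteq> U"
      using A unfolding A_def by auto
    have "ennreal (\<Sum>i<n. r i - l i) = (\<Sum>i<n. ennreal (r i - l i))"
      using I by (intro sum_ennreal[symmetric]) auto
    also have "\<dots> = (\<Sum>i<n. emeasure lebesgue {l i<..<r i})"
      using I by (intro sum.cong) auto
    also have "\<dots> = emeasure lebesgue (\<Union>i<n. {l i<..<r i})"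
      using D by (intro sum_emeasure) auto
    also have "\<dots> \<le> emeasure lebesgue U"
      using I U(1) by (intro emeasure_mono) auto
    also note U(3)
    finally have "(\<Sum>i<n. r i - l i) < \<delta>" 
      using I by (subst (asm) ennreal_less_iff) (auto intro!: sum_nonneg)
    then show ?thesis using \<delta>(2)[OF _ D] I \<open>a \<le> t\<close> v by force
  qed
  have bdd: "bdd_above (C t)" if "a \<le> t" for t using C_le that by (meson bdd_aboveI)
  \<comment> \<open>The empty family, \<open>n = 0\<close>, keeps \<open>C t\<close> nonempty, so
    that its supremum is meaningful.\<close>
  have "0 \<in> C t" for t
    unfolding C_def A_def by (force intro!: exI[of _ 0] simp: disjoint_family_on_def)
  then have C_ne: "C t \<noteq> {}" for t by blast
  have M_le: "M t \<le> e" if "a \<le> t" for t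
    unfolding M_def using C_le C_ne that by (meson cSup_least)
  have M_nonneg: "0 \<le> M t" if "a \<le> t" for t
    unfolding M_def using bdd[OF that] \<open>0 \<in> C t\<close> by (meson cSup_upper)
  have M_anti: "M t \<le> M s" if "a \<le> s" "s \<le> t" for s t
  proof -
    have "C t \<subseteq> C s" unfolding C_def A_def using \<open>s \<le> t\<close> by fastforce
    then show ?thesis unfolding M_def using bdd[OF \<open>a \<le> s\<close>] C_ne by (meson cSup_subset_mono)
  qed
  have M_step: "\<bar>h t - h s\<bar> + M t \<le> M s" if st: "a \<le> s" "s \<le> t" "t \<le> b" "{s<..<t} \<subseteq> U" for s t
  proof -
    have "v \<le> M s - \<bar>h t - h s\<bar>" if "v \<in> C t" for v
    proof -
      obtain n l r where v: "v = (\<Sum>i<n. norm (h (r i) - h (l i)))" and A: "A t n l r"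
        using \<open>v \<in> C t\<close> unfolding C_def by blast
      \<comment> \<open>The interval from \<open>s\<close> to \<open>t\<close> is appended to a
        family that lives in \<open>{t..b}\<close>, hence stays disjoint from it.\<close>
      define l' r' where "l' = l(n := s)" and "r' = r(n := t)"
      have "A s (Suc n) l' r'"
        unfolding A_def
      proof (intro conjI allI impI)
        show "disjoint_family_on (\<lambda>i. {l' i<..<r' i}) {..<Suc n}"
          using A unfolding A_def l'_def r'_def disjoint_family_on_def lessThan_Suc by fastforce
      qed (use A st in \<open>auto simp: A_def l'_def r'_def less_Suc_eq\<close>)
      then have "(\<Sum>i<Suc n. norm (h (r' i) - h (l' i))) \<in> C s" unfolding C_def by blast
      then have "(\<Sum>i<Suc n. norm (h (r' i) - h (l' i))) \<le> M s"
        unfolding M_def using bdd[OF \<open>a \<le> s\<close>] by (meson cSup_upper)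
      moreover have "(\<Sum>i<Suc n. norm (h (r' i) - h (l' i))) = v + \<bar>h t - h s\<bar>"
        unfolding v l'_def r'_def by simp
      ultimately show ?thesis by simp
    qed
    then have "M t \<le> M s - \<bar>h t - h s\<bar>" unfolding M_def[of t] using C_ne by (meson cSup_least)
    then show ?thesis by simp
  qed
  \<comment> \<open>Continuous induction from \<open>b\<close> down to \<open>a\<close>: it remains
    to show that \<open>S\<close> contains its infimum and that this infimum is
    \<open>a\<close>.\<close>
  define S where "S = {t \<in> {a..b}. h b - h t \<le> e * (b - t) + M t}"
  have "b \<in> S" using M_nonneg \<open>a \<le> b\<close> by (simp add: S_def)
  have S_bdd: "bdd_below S" by (intro bdd_belowI[of _ a]) (simp add: S_def)
  define \<tau> where "\<tau> = Inf S"
  have \<tau>: "a \<le> \<tau>" "\<tau> \<le> b"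
    using \<open>b \<in> S\<close> S_bdd unfolding \<tau>_def by (auto intro!: cInf_greatest cInf_lower simp: S_def)
  have "\<tau> \<in> S"
  proof -
    \<comment> \<open>Points of \<open>S\<close> just to the right of \<open>\<tau>\<close> pass the
      bound on, by continuity of \<open>h\<close>; for \<open>M\<close> monotonicity is
      enough.\<close>
    have "h b - h \<tau> \<le> (e * (b - \<tau>) + M \<tau>) + \<eta>" if "\<eta> > 0" for \<eta>
    proof -
      obtain d where d: "d > 0" "\<And>t. t \<in> {a..b} \<Longrightarrow> dist t \<tau> < d \<Longrightarrow> dist (h t) (h \<tau>) < \<eta>"
        using abs_continuous_on_imp_continuous_on[OF AC] \<tau> \<open>\<eta> > 0\<close>
        unfolding continuous_on_iff by (meson atLeastAtMost_iff)
      obtain t where t: "t \<in> S" "t < \<tau> + d"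
        using cInf_lessD[of S "\<tau> + d"] \<open>b \<in> S\<close> d(1) unfolding \<tau>_def by auto
      have "\<tau> \<le> t" unfolding \<tau>_def using t S_bdd by (simp add: cInf_lower)
      have "h t - h \<tau> < \<eta>" using d(2)[of t] t \<open>\<tau> \<le> t\<close> by (auto simp: S_def dist_real_def)
      moreover have "h b - h t \<le> e * (b - t) + M t" using t by (simp add: S_def)
      moreover have "e * (b - t) \<le> e * (b - \<tau>)" using \<open>e > 0\<close> \<open>\<tau> \<le> t\<close> by simp
      moreover have "M t \<le> M \<tau>" using M_anti \<tau> \<open>\<tau> \<le> t\<close> by simp
      ultimately show ?thesis by linarith
    qed
    then have "h b - h \<tau> \<le> e * (b - \<tau>) + M \<tau>" by (rule field_le_epsilon)
    then show ?thesis using \<tau> by (simp add: S_def)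
  qed
  then have \<tau>_ineq: "h b - h \<tau> \<le> e * (b - \<tau>) + M \<tau>" by (simp add: S_def)
  have "\<tau> = a"
  proof (rule ccontr)
    assume "\<tau> \<noteq> a"
    then have "a < \<tau>" using \<tau> by simp
    have "\<exists>s. a \<le> s \<and> s < \<tau> \<and> s \<in> S"
    \<comment> \<open>On the exceptional set the increment of \<open>h\<close> is charged to
      \<open>M\<close>; elsewhere the touching function has slope below \<open>e\<close> just to the
      left of \<open>\<tau>\<close>.\<close>
    proof (cases "\<tau> \<in> insert b N")
      case True
      then have "\<tau> \<in> U" using U by blast
      then obtain d where d: "d > 0" "ball \<tau> d \<subseteq> U" using U(1) open_contains_ball by blast
      define s where "s = max a (\<tau> - d / 2)"
      have s: "a \<le> s" "s < \<tau>" using \<open>a < \<tau>\<close> d by (auto simp: s_def)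
      have "{s<..<\<tau>} \<subseteq> ball \<tau> d" using d(1) by (auto simp: s_def dist_real_def)
      then have "\<bar>h \<tau> - h s\<bar> + M \<tau> \<le> M s" using M_step[of s \<tau>] s \<tau> d by auto
      moreover have "e * (b - \<tau>) \<le> e * (b - s)" using \<open>e > 0\<close> s by simp
      ultimately have "s \<in> S" using \<tau>_ineq s \<tau> by (auto simp: S_def)
      then show ?thesis using s by blast
    next
      case False
      then have "\<tau> \<in> {a<..<b}" using \<open>a < \<tau>\<close> \<tau> by auto
      then obtain d where "d \<le> 0" "left_support a h \<tau> d" using N(2) False by blast
      then obtain p where p: "(p has_real_derivative d) (at \<tau>)" "d \<le> 0" "p \<tau> = h \<tau>"
          "\<And>s. s \<in> {a..\<tau>} \<Longrightarrow> p s \<le> h s"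
        unfolding left_support_def by blast
      have "(\<lambda>s. (p s - p \<tau>) / (s - \<tau>)) \<midarrow>\<tau>\<rightarrow> d" using p(1) by (simp add: has_field_derivative_iff)
      then have "\<forall>\<^sub>F s in at \<tau>. (p s - p \<tau>) / (s - \<tau>) < e"
        using order_tendstoD(2) p(2) \<open>e > 0\<close> by (metis order_le_less_trans)
      then obtain \<eta> where \<eta>: "\<eta> > 0" "\<And>s. s \<noteq> \<tau> \<Longrightarrow> dist s \<tau> < \<eta> \<Longrightarrow> (p s - p \<tau>) / (s - \<tau>) < e"
        unfolding eventually_at by auto
      define s where "s = max a (\<tau> - \<eta> / 2)"
      have s: "a \<le> s" "s < \<tau>" using \<open>a < \<tau>\<close> \<eta> by (auto simp: s_def)
      have "dist s \<tau> < \<eta>" using \<eta>(1) s by (auto simp: s_def dist_real_def)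
      then have "(p s - p \<tau>) / (s - \<tau>) < e" using \<eta>(2) s by auto
      then have "p \<tau> - p s < e * (\<tau> - s)" using s by (simp add: divide_less_eq algebra_simps)
      then have "h \<tau> - h s \<le> e * (\<tau> - s)" using p(3) p(4)[of s] s by auto
      moreover have "M \<tau> \<le> M s" using M_anti s by simp
      ultimately have "h b - h s \<le> e * (b - s) + M s" using \<tau>_ineq by (simp add: algebra_simps)
      then have "s \<in> S" using s \<tau> by (auto simp: S_def)
      then show ?thesis using s by blast
    qed
    then show False using cInf_lower[OF _ S_bdd] unfolding \<tau>_def by fastforce
  qed
  then show "h b \<le> h a + \<epsilon>" using \<tau>_ineq M_le[of a] e by simp
qed

section \<open>Lipschitz regularity of dissipative evolutions\<close>

lemma has_real_derivative_norm_square: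
  fixes X :: "real \<Rightarrow> 'a::real_inner"
  assumes "(X has_vector_derivative V) (at t)"
  shows "((\<lambda>s. (norm (X s))\<^sup>2) has_real_derivative 2 * (V \<bullet> X t)) (at t)"
  using bounded_bilinear.has_vector_derivative[OF bounded_bilinear_inner assms assms]
  by (simp add: power2_norm_eq_inner has_real_derivative_iff_has_vector_derivative inner_commute)

text \<open>A longer interval is cut into equal pieces shorter than \<open>\<eta>\<close>, and the
  linear bounds on the pieces add up.\<close>

lemma lipschitz_on_of_uniform_increments:
  fixes f :: "real \<Rightarrow> 'a::real_normed_vector"
  assumes "\<eta> > 0" "0 \<le> L"
    and inc: "\<And>t h. a \<le> t \<Longrightarrow> 0 < h \<Longrightarrow> h < \<eta> \<Longrightarrow> t + h \<le> b \<Longrightarrow> norm (f (t + h) - f t) \<le> L * h"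
  shows "L-lipschitz_on {a..b} f"
proof -
  have *: "norm (f t - f s) \<le> L * (t - s)" if st: "a \<le> s" "s < t" "t \<le> b" for s t
  proof -
    obtain n :: nat where n: "(t - s) / \<eta> < real n" using reals_Archimedean2 by blast
    have "0 < (t - s) / \<eta>" using st \<open>\<eta> > 0\<close> by simp
    then have "0 < real n" using n by linarith
    define h where "h = (t - s) / real n"
    have h: "0 < h" "h < \<eta>" "real n * h = t - s"
      using st \<open>0 < real n\<close> n \<open>\<eta> > 0\<close> by (auto simp: h_def field_simps)
    have "norm (f (s + real k * h) - f s) \<le> L * (real k * h)" if "k \<le> n" for k
      using that
    proof (induction k)
      case (Suc k)
      have "real (Suc k) * h \<le> real n * h" using Suc.prems h(1) by (intro mult_right_mono) auto
      then have "norm (f (s + real k * h + h) - f (s + real k * h)) \<le> L * h"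
        using st h(1-3) mult_nonneg_nonneg[of "real k" h]
        by (intro inc) (simp_all only: distrib_right of_nat_Suc, linarith+)
      moreover have eq: "s + real (Suc k) * h = s + real k * h + h" by (simp add: algebra_simps)
      ultimately have "norm (f (s + real (Suc k) * h) - f s) \<le> L * h + L * (real k * h)"
        unfolding eq using Suc.IH Suc.prems norm_triangle_ineq[of "f (s + real k * h + h) - f (s + real k * h)"
            "f (s + real k * h) - f s"] by (simp del: add.assoc)
      then show ?case by (simp add: algebra_simps)
    qed simp
    from this[of n] show ?thesis using h(3) by simp
  qed
  show ?thesis
  proof (rule lipschitz_onI)
    fix s t assume "s \<in> {a..b}" "t \<in> {a..b}"
    then show "dist (f s) (f t) \<le> L * dist s t"
      using *[of s t] *[of t s]
      by (cases s t rule: linorder_cases) (auto simp: dist_norm norm_minus_commute)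
  qed fact
qed

text \<open>Brezis' regularization: since the velocities at two times satisfy a one-sided Lipschitz
  estimate, Gronwall's inequality carries the bound on the difference quotient at one point of
  differentiability forward in time.\<close>

lemma one_sided_lipschitz_velocity_imp_lipschitz:
  fixes X V :: "real \<Rightarrow> 'a::real_inner"
  assumes AC: "abs_continuous_on {a..b} X" and "a < a'"
    and AE: "AE t in lebesgue. t \<in> {a<..<b} \<longrightarrow> G t"
    and V: "\<And>t. t \<in> {a<..<b} \<Longrightarrow> G t \<Longrightarrow> (X has_vector_derivative V t) (at t)"
    and K: "\<And>s t. s \<in> {a<..<b} \<Longrightarrow> t \<in> {a<..<b} \<Longrightarrow> G s \<Longrightarrow> G t \<Longrightarrow>
      (V t - V s) \<bullet> (X t - X s) \<le> K * ((norm (X t - X s))\<^sup>2 + (t - s)\<^sup>2)"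
  obtains L where "L-lipschitz_on {a'..b} X"
proof (cases "a' < b")
  case False
  then have "s = t" if "s \<in> {a'..b}" "t \<in> {a'..b}" for s t using that by auto
  then have "0-lipschitz_on {a'..b} X" by (intro lipschitz_onI) (metis dist_self mult_zero_left order_refl, simp)
  then show ?thesis using that by blast
next
  case True
  \<comment> \<open>Nonnegativity of \<open>r\<close> lets the exponential growth factor be bounded
    by the one over the whole length \<open>b - a\<close>.\<close>
  define r where "r = max 0 K"
  have "r \<ge> 0" by (simp add: r_def)
  have r: "(V t - V s) \<bullet> (X t - X s) \<le> r * ((norm (X t - X s))\<^sup>2 + (t - s)\<^sup>2)"
    if "s \<in> {a<..<b}" "t \<in> {a<..<b}" "G s" "G t" for s t
    using K[OF that] by (rule order_trans) (auto simp: r_def intro!: mult_right_mono)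
  have "AE t in lebesgue. t \<in> {a<..<a'} \<longrightarrow> G t" using AE True by (auto elim!: eventually_mono)
  then obtain s0 where s0: "s0 \<in> {a<..<a'}" "G s0"
    using AE_lebesgue_obtain_in_interval \<open>a < a'\<close> by metis
  \<comment> \<open>Differentiability at the single time \<open>s0\<close> bounds all short
    increments to its right by \<open>c\<close> times their length; the 1 absorbs the
    remainder.\<close>
  define c where "c = norm (V s0) + 1"
  have "(X has_derivative (\<lambda>h. h *\<^sub>R V s0)) (at s0)"
    using V[of s0] s0 True by (auto simp: has_vector_derivative_def)
  then obtain \<eta> where \<eta>: "\<eta> > 0" "\<And>t. norm (t - s0) < \<eta> \<Longrightarrow>
      norm (X t - X s0 - (t - s0) *\<^sub>R V s0) \<le> 1 * norm (t - s0)"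
    unfolding has_derivative_at_alt using zero_less_one by blast
  have start: "norm (X (s0 + h) - X s0) \<le> c * h" if h: "0 < h" "h < \<eta>" for h
  proof -
    have "norm (X (s0 + h) - X s0) \<le> norm (X (s0 + h) - X s0 - h *\<^sub>R V s0) + norm (h *\<^sub>R V s0)"
      by (metis diff_add_cancel norm_triangle_ineq)
    also have "\<dots> \<le> h + h * norm (V s0)" using \<eta>(2)[of "s0 + h"] h by simp
    finally show ?thesis by (simp add: c_def algebra_simps)
  qed
  define L where "L = sqrt (exp (2 * r * (b - a)) * (c\<^sup>2 + 1))"
  have "L \<ge> 0" by (simp add: L_def)
  have "L-lipschitz_on {s0..b} X"
  proof (rule lipschitz_on_of_uniform_increments[OF \<eta>(1) \<open>L \<ge> 0\<close>])
    fix t h assume th: "s0 \<le> t" "0 < h" "h < \<eta>" "t + h \<le> b"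
    \<comment> \<open>The Gronwall quantity for \<open>X\<close> and its translate. The summand
      \<open>h\<^sup>2\<close> matches the \<open>(t - s)\<^sup>2\<close> in the hypothesis, which
      accounts for an explicit dependence of the velocity on time; with it the derivative of
      \<open>D\<close> is nonpositive.\<close>
    define D where "D s = exp (- (2 * r * s)) * ((norm (X (s + h) - X s))\<^sup>2 + h\<^sup>2)" for s
    have "D t \<le> D s0"
    proof (rule abs_continuous_on_nonincreasing[OF \<open>s0 \<le> t\<close>])
      have "abs_continuous_on {s0..t} X" "abs_continuous_on {s0..t} (\<lambda>s. X (s + h))"
        using AC s0 th by (auto intro: abs_continuous_on_subset abs_continuous_on_shift)
      moreover have "abs_continuous_on {s0..t} (\<lambda>s. exp (- (2 * r * s)))"
        by (rule abs_continuous_on_C1[where f' = "\<lambda>s. - (2 * r) * exp (- (2 * r * s))"])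
          (auto intro!: derivative_eq_intros continuous_intros)
      ultimately show "abs_continuous_on {s0..t} D"
        unfolding D_def by (intro abs_continuous_on_mult abs_continuous_on_add
            abs_continuous_on_norm_square abs_continuous_on_diff abs_continuous_on_const) auto
      have key: "\<exists>d\<le>0. left_support s0 D s d"
        if s: "s \<in> {s0<..<t}" "s \<in> {a<..<b} \<longrightarrow> G s" "s + h \<in> {a<..<b} \<longrightarrow> G (s + h)" for s
      proof -
        have s': "s \<in> {a<..<b}" "s + h \<in> {a<..<b}" using s s0 th by auto
        have "((\<lambda>s. s + h) has_vector_derivative 1) (at s)"
          unfolding has_real_derivative_iff_has_vector_derivative[symmetric]
          by (auto intro!: derivative_eq_intros)
        then have "((\<lambda>s. X (s + h)) has_vector_derivative V (s + h)) (at s)"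
          using vector_diff_chain_at[of "\<lambda>s. s + h" 1 s X "V (s + h)"] V[of "s + h"] s s'
          by (simp add: o_def)
        then have dX: "((\<lambda>s. X (s + h) - X s) has_vector_derivative V (s + h) - V s) (at s)"
          using V[of s] s s' by (intro has_vector_derivative_diff) auto
        let ?w = "X (s + h) - X s" and ?v = "V (s + h) - V s"
        have dE: "((\<lambda>s. exp (- (2 * r * s))) has_real_derivative - (2 * r) * exp (- (2 * r * s))) (at s)"
          by (auto intro!: derivative_eq_intros)
        have "(D has_real_derivative - (2 * r) * exp (- (2 * r * s)) * ((norm ?w)\<^sup>2 + h\<^sup>2)
            + (2 * (?v \<bullet> ?w) + 0) * exp (- (2 * r * s))) (at s)"
          unfolding D_def
          by (rule DERIV_mult[OF dE DERIV_add[OF has_real_derivative_norm_square[OF dX] DERIV_const]])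
        moreover have "- (2 * r) * exp (- (2 * r * s)) * ((norm ?w)\<^sup>2 + h\<^sup>2)
            + (2 * (?v \<bullet> ?w) + 0) * exp (- (2 * r * s))
            = 2 * exp (- (2 * r * s)) * (?v \<bullet> ?w - r * ((norm ?w)\<^sup>2 + h\<^sup>2))"
          by (simp add: algebra_simps)
        moreover have "\<dots> \<le> 0"
          using r[of s "s + h"] s s' by (intro mult_nonneg_nonpos) auto
        ultimately show ?thesis unfolding left_support_def by fastforce
      qed
      then show "AE s in lebesgue. s \<in> {s0<..<t} \<longrightarrow> (\<exists>d\<le>0. left_support s0 D s d)"
        using AE AE_lebesgue_shift[OF AE, of h] by eventually_elim (intro impI key; blast)
    qed
    also have "D s0 \<le> exp (- (2 * r * s0)) * ((c * h)\<^sup>2 + h\<^sup>2)"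
      unfolding D_def using start[OF th(2,3)] th(2) by (intro mult_left_mono add_mono power_mono) auto
    finally have "exp (2 * r * t) * D t \<le> exp (2 * r * t) * (exp (- (2 * r * s0)) * ((c * h)\<^sup>2 + h\<^sup>2))"
      by simp
    also have "\<dots> = exp (2 * r * (t - s0)) * ((c\<^sup>2 + 1) * h\<^sup>2)"
      by (simp add: exp_diff exp_minus field_simps)
    also have "\<dots> \<le> exp (2 * r * (b - a)) * ((c\<^sup>2 + 1) * h\<^sup>2)"
      using th s0 \<open>r \<ge> 0\<close> by (intro mult_right_mono) (auto intro!: mult_left_mono)
    also have "\<dots> = (L * h)\<^sup>2" by (simp add: L_def power_mult_distrib)
    finally have "exp (2 * r * t) * D t \<le> (L * h)\<^sup>2" .
    moreover have "exp (2 * r * t) * D t = (norm (X (t + h) - X t))\<^sup>2 + h\<^sup>2"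
      unfolding D_def mult.assoc[symmetric] exp_add[symmetric] by simp
    ultimately have "(norm (X (t + h) - X t))\<^sup>2 \<le> (L * h)\<^sup>2"
      using zero_le_power2[of h] by linarith
    then show "norm (X (t + h) - X t) \<le> L * h"
      using power2_le_imp_le \<open>L \<ge> 0\<close> th(2) by (meson less_imp_le mult_nonneg_nonneg)
  qed
  then have "L-lipschitz_on {a'..b} X" using s0 by (auto intro: lipschitz_on_subset)
  then show ?thesis using that by blast
qed

section \<open>Subgradients along a curve\<close>

text \<open>The lower limit is taken over the punctured filter; the centre is covered by
  \<open>r < \<phi> x\<close>.\<close>

lemma lower_semicontinuous_eventually:
  assumes "lower_semicontinuous \<phi>" "r < \<phi> x"
  shows "\<forall>\<^sub>F z in nhds x. r < \<phi> z"
proof -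
  have "r < Liminf (at x) \<phi>" using assms unfolding lower_semicontinuous_def by (meson less_le_trans)
  then have "\<forall>\<^sub>F z in at x. r < \<phi> z" by (rule less_LiminfD)
  then show ?thesis using assms(2) by (simp add: eventually_nhds_conv_at)
qed

lemma subdifferential_imp_finite:
  assumes "proper \<phi>" "g \<in> subdifferential \<phi> x"
  shows "\<bar>\<phi> x\<bar> \<noteq> \<infinity>"
proof
  assume *: "\<bar>\<phi> x\<bar> = \<infinity>"
  obtain z where z: "\<phi> z \<noteq> \<infinity>" using assms(1) unfolding proper_def by blast
  have "\<phi> x + ereal (g \<bullet> (z - x)) \<le> \<phi> z" using assms(2) unfolding subdifferential_def by blast
  moreover have "\<phi> x = \<infinity>" using * assms(1) unfolding proper_def by (cases "\<phi> x") auto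
  ultimately show False using z by simp
qed

lemma subgradient_inequality:
  assumes "proper \<phi>" "g \<in> subdifferential \<phi> x" "\<phi> z \<noteq> \<infinity>"
  shows "real_of_ereal (\<phi> x) + g \<bullet> (z - x) \<le> real_of_ereal (\<phi> z)"
proof -
  have "\<phi> x + ereal (g \<bullet> (z - x)) \<le> \<phi> z" using assms(2) unfolding subdifferential_def by blast
  then show ?thesis using subdifferential_imp_finite[OF assms(1,2)] assms(1,3)
    unfolding proper_def by (cases "\<phi> x"; cases "\<phi> z") auto
qed

text \<open>Sum of the two subgradient inequalities; finiteness lets the values of
  \<open>\<phi>\<close> cancel.\<close>

lemma subdifferential_monotone:
  assumes "proper \<phi>" "g \<in> subdifferential \<phi> x" "g' \<in> subdifferential \<phi> x'"
  shows "0 \<le> (g - g') \<bullet> (x - x')"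
  using subgradient_inequality[OF assms(1,2), of x'] subgradient_inequality[OF assms(1,3), of x]
    subdifferential_imp_finite[OF assms(1,2)] subdifferential_imp_finite[OF assms(1,3)]
  by (auto simp: inner_diff_left inner_diff_right)

text \<open>Times with a small subgradient are dense. Between two of them the subgradient inequality
  gives the Lipschitz bound, and lower semicontinuity carries it, together with finiteness, to the
  remaining times.\<close>

lemma bounded_subgradients_imp_lipschitz_composition:
  fixes \<phi> :: "'a::real_inner \<Rightarrow> ereal" and x :: "real \<Rightarrow> 'a"
  assumes "proper \<phi>" "lower_semicontinuous \<phi>" "a < b" and x: "L-lipschitz_on {a..b} x"
    and AE: "AE t in lebesgue. t \<in> {a<..<b} \<longrightarrow> (\<exists>g\<in>subdifferential \<phi> (x t). norm g \<le> C)"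
  shows "\<forall>t\<in>{a..b}. \<phi> (x t) \<noteq> \<infinity>"
    and "(C * L)-lipschitz_on {a..b} (\<lambda>t. real_of_ereal (\<phi> (x t)))"
proof -
  define F where "F t = real_of_ereal (\<phi> (x t))" for t
  define good where "good = {t \<in> {a<..<b}. \<exists>g\<in>subdifferential \<phi> (x t). norm g \<le> C}"
  have dense: "\<exists>t\<in>good. c < t \<and> t < d" if cd: "a \<le> c" "c < d" "d \<le> b" for c d
  proof -
    have "AE t in lebesgue. t \<in> {c<..<d} \<longrightarrow> t \<in> good"
      using AE by eventually_elim (use cd in \<open>auto simp: good_def\<close>)
    then show ?thesis using AE_lebesgue_obtain_in_interval \<open>c < d\<close> by (metis greaterThanLessThan_iff)
  qed
  have fin: "\<bar>\<phi> (x s)\<bar> \<noteq> \<infinity>" if "s \<in> good" for s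
    using that by (auto simp: good_def dest: subdifferential_imp_finite[OF assms(1)])
  have L: "0 \<le> L" using lipschitz_on_nonneg[OF x] .
  have C: "0 \<le> C" using dense[of a b] \<open>a < b\<close> norm_ge_zero order_trans unfolding good_def by blast
  have lower: "F s \<le> F t + C * L * \<bar>t - s\<bar>" if s: "s \<in> good" and t: "t \<in> {a..b}" "\<phi> (x t) \<noteq> \<infinity>" for s t
  proof -
    obtain g where g: "g \<in> subdifferential \<phi> (x s)" "norm g \<le> C" using s unfolding good_def by blast
    have "\<bar>g \<bullet> (x t - x s)\<bar> \<le> norm g * norm (x t - x s)" by (rule Cauchy_Schwarz_ineq2)
    also have "\<dots> \<le> C * (L * \<bar>t - s\<bar>)"
      using g(2) s t C lipschitz_onD[OF x, of t s]
      by (intro mult_mono) (auto simp: good_def dist_norm)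
    finally show ?thesis using subgradient_inequality[OF assms(1) g(1) t(2)] by (simp add: F_def)
  qed
  \<comment> \<open>Stated in the extended reals because finiteness at \<open>t\<close> is only a
    consequence. If it failed, lower semicontinuity would keep the values above \<open>r\<close>
    near \<open>t\<close>, against the bound at good times close to \<open>t\<close>.\<close>
  have upper: "\<phi> (x t) \<le> ereal (F s + C * L * \<bar>t - s\<bar>)" if s: "s \<in> good" and t: "t \<in> {a..b}" for s t
  proof (rule ccontr)
    assume "\<not> ?thesis"
    then obtain r where r: "F s + C * L * \<bar>t - s\<bar> < r" "ereal r < \<phi> (x t)"
      by (metis ereal_dense2 ereal_less(2) less_ereal.simps(1) linorder_not_le)
    have "((\<lambda>t'. x t') \<longlongrightarrow> x t) (at t within {a..b})"
      using lipschitz_on_continuous_on[OF x] t by (auto simp: continuous_on_def)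
    then have "\<forall>\<^sub>F t' in at t within {a..b}. ereal r < \<phi> (x t')"
      using lower_semicontinuous_eventually[OF assms(2) r(2)] unfolding filterlim_iff by blast
    then obtain d where d: "d > 0" "\<And>t'. t' \<in> {a..b} \<Longrightarrow> dist t' t < d \<Longrightarrow> ereal r < \<phi> (x t')"
      using r(2) unfolding eventually_at by (metis dist_self)
    \<comment> \<open>Small enough that an error of \<open>C * L * e\<close> stays inside the gap
      below \<open>r\<close>; the 1 covers the case \<open>C * L = 0\<close>.\<close>
    define e where "e = min d ((r - (F s + C * L * \<bar>t - s\<bar>)) / (C * L + 1))"
    have CL: "0 < C * L + 1" using C L by (simp add: add_nonneg_pos)
    then have "e > 0" using d(1) r(1) by (simp add: e_def)
    then obtain t' where t': "t' \<in> good" "max a (t - e) < t'" "t' < min b (t + e)"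
      using dense[of "max a (t - e)" "min b (t + e)"] t \<open>a < b\<close> by auto
    have near: "\<bar>t' - t\<bar> < e" using t' by auto
    have "C * L * \<bar>t' - t\<bar> \<le> (C * L + 1) * \<bar>t' - t\<bar>" by (simp add: algebra_simps)
    also have "\<dots> < (C * L + 1) * e" using near CL by (rule mult_strict_left_mono)
    also have "\<dots> \<le> r - (F s + C * L * \<bar>t - s\<bar>)"
    proof -
      have "e \<le> (r - (F s + C * L * \<bar>t - s\<bar>)) / (C * L + 1)" by (simp add: e_def)
      then show ?thesis using CL by (simp only: pos_le_divide_eq mult.commute[of e])
    qed
    finally have "F s + C * L * (\<bar>t - s\<bar> + \<bar>t' - t\<bar>) < r" by (simp add: algebra_simps)
    moreover have "C * L * \<bar>s - t'\<bar> \<le> C * L * (\<bar>t - s\<bar> + \<bar>t' - t\<bar>)"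
      using C L by (intro mult_left_mono) auto
    moreover have "F t' \<le> F s + C * L * \<bar>s - t'\<bar>"
      using lower[OF t'(1), of s] s fin[OF s] by (auto simp: good_def)
    ultimately have "F t' < r" by linarith
    moreover have "ereal r < ereal (F t')"
      using d(2)[of t'] t' near fin[OF t'(1)] by (auto simp: e_def F_def dist_real_def ereal_real')
    ultimately show False by simp
  qed
  show fin': "\<forall>t\<in>{a..b}. \<phi> (x t) \<noteq> \<infinity>" using upper dense[of a b] \<open>a < b\<close> by fastforce
  have close: "\<bar>F t - F s\<bar> \<le> C * L * \<bar>t - s\<bar>" if s: "s \<in> good" and t: "t \<in> {a..b}" for s t
  proof -
    have "\<phi> (x t) = ereal (F t)"
      using fin' t assms(1) unfolding F_def proper_def by (cases "\<phi> (x t)") auto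
    then show ?thesis using upper[OF s t] lower[OF s t] by auto
  qed
  show "(C * L)-lipschitz_on {a..b} (\<lambda>t. real_of_ereal (\<phi> (x t)))"
    unfolding F_def[symmetric]
  proof (rule lipschitz_onI)
    have *: "\<bar>F t - F s\<bar> \<le> C * L * \<bar>t - s\<bar>" if "s \<in> {a..b}" "t \<in> {a..b}" "s < t" for s t
    proof -
      \<comment> \<open>A good time between \<open>s\<close> and \<open>t\<close> loses nothing in
        the constant: the two lengths add up to \<open>t - s\<close>.\<close>
      obtain m where m: "m \<in> good" "s < m" "m < t" using dense[of s t] \<open>s \<in> {a..b}\<close> \<open>t \<in> {a..b}\<close> \<open>s < t\<close> by auto
      have "\<bar>F t - F s\<bar> \<le> C * L * \<bar>t - m\<bar> + C * L * \<bar>s - m\<bar>"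
        using close[OF m(1), of t] close[OF m(1), of s] that by linarith
      also have "\<dots> = C * L * \<bar>t - s\<bar>" using m by (simp add: algebra_simps)
      finally show ?thesis .
    qed
    fix s t assume "s \<in> {a..b}" "t \<in> {a..b}"
    then show "dist (F s) (F t) \<le> C * L * dist s t"
      using *[of s t] *[of t s]
      by (cases s t rule: linorder_cases) (auto simp: dist_real_def abs_minus_commute)
  qed (use C L in simp)
qed

section \<open>Lyapunov analysis\<close>

lemma antimono_on_bounded_below_convergent:
  fixes h :: "real \<Rightarrow> real"
  assumes anti: "\<And>s t. T \<le> s \<Longrightarrow> s \<le> t \<Longrightarrow> h t \<le> h s" and nonneg: "\<And>t. T \<le> t \<Longrightarrow> 0 \<le> h t"
  obtains l where "(h \<longlongrightarrow> l) at_top"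
proof
  have bdd: "bdd_below (h ` {T..})" using nonneg by (intro bdd_belowI2) auto
  show "(h \<longlongrightarrow> Inf (h ` {T..})) at_top"
  proof (rule decreasing_tendsto)
    show "\<forall>\<^sub>F t in at_top. Inf (h ` {T..}) \<le> h t"
      using eventually_ge_at_top[of T] by eventually_elim (use bdd in \<open>auto intro: cINF_lower\<close>)
    fix y assume "Inf (h ` {T..}) < y"
    then obtain s where s: "T \<le> s" "h s < y" using cInf_lessD[of "h ` {T..}" y] by auto
    show "\<forall>\<^sub>F t in at_top. h t < y"
      using eventually_ge_at_top[of s] by eventually_elim (use anti s in \<open>meson order_le_less_trans\<close>)
  qed
qed

text \<open>The weight of \<open>f\<close> is tuned so that the products of \<open>\<xi>\<close>
  with \<open>u\<close> cancel in the derivative, the weight of the last square so that those of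
  \<open>u\<close> with \<open>x - z\<close> cancel.\<close>

definition energy ::
  "real \<Rightarrow> real \<Rightarrow> 'a::real_inner \<Rightarrow> (real \<Rightarrow> 'a) \<Rightarrow> (real \<Rightarrow> 'a) \<Rightarrow> (real \<Rightarrow> real) \<Rightarrow> real \<Rightarrow> real \<Rightarrow> real"
where
  "energy \<alpha> \<beta> z x u f \<mu> t = t * (t - \<beta> * (\<alpha> - \<mu>)) * f t
     + 1/2 * (norm (\<mu> *\<^sub>R (x t - z) + t *\<^sub>R u t))\<^sup>2 + \<mu> * (\<alpha> - 1 - \<mu>) / 2 * (norm (x t - z))\<^sup>2"

text \<open>The hypothesis on \<open>f\<close> is the formal chain rule; it will be met by a
  linearised gap instead of the gap itself.\<close>

lemma energy_has_real_derivative: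
  fixes x u :: "real \<Rightarrow> 'a::real_inner"
  assumes "t > 0"
    and x: "(x has_vector_derivative u t - \<beta> *\<^sub>R \<xi>) (at t)"
    and u: "(u has_vector_derivative - (\<alpha> / t) *\<^sub>R (u t - \<beta> *\<^sub>R \<xi>) - \<xi>) (at t)"
    and f: "(f has_real_derivative \<xi> \<bullet> (u t - \<beta> *\<^sub>R \<xi>)) (at t)"
  shows "(energy \<alpha> \<beta> z x u f \<mu> has_real_derivative
      (2 * t - \<beta> * (\<alpha> - \<mu>)) * f t - \<beta> * t * (t - \<beta> * (\<alpha> - \<mu>)) * (norm \<xi>)\<^sup>2
      - \<mu> * (t - \<beta>) * (\<xi> \<bullet> (x t - z)) - (\<alpha> - 1 - \<mu>) * t * (norm (u t))\<^sup>2) (at t)"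
proof -
  let ?x' = "u t - \<beta> *\<^sub>R \<xi>" and ?v = "x t - z"
  let ?w = "\<mu> *\<^sub>R (x t - z) + t *\<^sub>R u t"
  let ?w' = "(\<mu> + 1 - \<alpha>) *\<^sub>R u t - (t - \<alpha> * \<beta> + \<mu> * \<beta>) *\<^sub>R \<xi>"
  have dv: "((\<lambda>s. x s - z) has_vector_derivative ?x') (at t)"
    using has_vector_derivative_diff[OF x has_vector_derivative_const[of z]] by simp
  have "((\<lambda>s. s *\<^sub>R u s) has_vector_derivative
      t *\<^sub>R (- (\<alpha> / t) *\<^sub>R ?x' - \<xi>) + 1 *\<^sub>R u t) (at t)"
    by (rule has_vector_derivative_scaleR[OF DERIV_ident u])
  then have "((\<lambda>s. \<mu> *\<^sub>R (x s - z) + s *\<^sub>R u s) has_vector_derivative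
      \<mu> *\<^sub>R ?x' + (t *\<^sub>R (- (\<alpha> / t) *\<^sub>R ?x' - \<xi>) + 1 *\<^sub>R u t)) (at t)"
    using has_vector_derivative_add[OF bounded_linear.has_vector_derivative[OF bounded_linear_scaleR_right dv]]
    by blast
  \<comment> \<open>Multiplication by \<open>t\<close> removes the singular friction coefficient:
    \<open>t u' = - \<alpha> x' - t \<xi>\<close>.\<close>
  moreover have "\<mu> *\<^sub>R ?x' + (t *\<^sub>R (- (\<alpha> / t) *\<^sub>R ?x' - \<xi>) + 1 *\<^sub>R u t) = ?w'"
    using \<open>t > 0\<close> by (simp add: algebra_simps)
  ultimately have dw: "((\<lambda>s. \<mu> *\<^sub>R (x s - z) + s *\<^sub>R u s) has_vector_derivative ?w') (at t)" by simp
  have da: "((\<lambda>s. s * (s - \<beta> * (\<alpha> - \<mu>))) has_real_derivative 2 * t - \<beta> * (\<alpha> - \<mu>)) (at t)"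
    by (auto intro!: derivative_eq_intros)
  have "(energy \<alpha> \<beta> z x u f \<mu> has_real_derivative
      ((2 * t - \<beta> * (\<alpha> - \<mu>)) * f t + (\<xi> \<bullet> ?x') * (t * (t - \<beta> * (\<alpha> - \<mu>)))
       + 1/2 * (2 * (?w' \<bullet> ?w))) + \<mu> * (\<alpha> - 1 - \<mu>) / 2 * (2 * (?x' \<bullet> ?v))) (at t)"
    unfolding energy_def
    by (intro DERIV_add DERIV_mult[OF da f] DERIV_cmult has_real_derivative_norm_square dv dw)
  moreover have "((2 * t - \<beta> * (\<alpha> - \<mu>)) * f t + (\<xi> \<bullet> ?x') * (t * (t - \<beta> * (\<alpha> - \<mu>)))
       + 1/2 * (2 * (?w' \<bullet> ?w))) + \<mu> * (\<alpha> - 1 - \<mu>) / 2 * (2 * (?x' \<bullet> ?v))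
     = (2 * t - \<beta> * (\<alpha> - \<mu>)) * f t - \<beta> * t * (t - \<beta> * (\<alpha> - \<mu>)) * (norm \<xi>)\<^sup>2
      - \<mu> * (t - \<beta>) * (\<xi> \<bullet> ?v) - (\<alpha> - 1 - \<mu>) * t * (norm (u t))\<^sup>2"
  proof -
    define v where "v = x t - z"
    have uv: "v \<bullet> u t = u t \<bullet> v" "u t \<bullet> \<xi> = \<xi> \<bullet> u t" "v \<bullet> \<xi> = \<xi> \<bullet> v" by (simp_all add: inner_commute)
    show ?thesis
      unfolding v_def[symmetric] power2_norm_eq_inner
      by (simp add: inner_add_left inner_add_right inner_diff_left inner_diff_right uv)
        (simp add: field_simps)
  qed
  ultimately show ?thesis by (simp only:)
qed

text \<open>The gap is replaced by its linearisation \<open>g\<close> along the curve, which is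
  differentiable at \<open>t\<close> and lies below \<open>f\<close> by the subgradient inequality.
  As \<open>\<beta> * (\<alpha> - \<mu>) \<le> T\<close> makes the weight of the gap nonnegative,
  the energy of \<open>g\<close> lies below that of \<open>f\<close>.\<close>

lemma energy_left_support:
  fixes x u :: "real \<Rightarrow> 'a::real_inner"
  assumes "0 < T" "T \<le> t" "\<beta> * (\<alpha> - \<mu>) \<le> T"
    and x: "(x has_vector_derivative u t - \<beta> *\<^sub>R \<xi>) (at t)"
    and u: "(u has_vector_derivative - (\<alpha> / t) *\<^sub>R (u t - \<beta> *\<^sub>R \<xi>) - \<xi>) (at t)"
    and f: "\<And>s. T \<le> s \<Longrightarrow> f t + \<xi> \<bullet> (x s - x t) \<le> f s"
  shows "left_support T (energy \<alpha> \<beta> z x u f \<mu>) t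
      ((2 * t - \<beta> * (\<alpha> - \<mu>)) * f t - \<beta> * t * (t - \<beta> * (\<alpha> - \<mu>)) * (norm \<xi>)\<^sup>2
      - \<mu> * (t - \<beta>) * (\<xi> \<bullet> (x t - z)) - (\<alpha> - 1 - \<mu>) * t * (norm (u t))\<^sup>2)"
proof -
  define g where "g s = f t + \<xi> \<bullet> (x s - x t)" for s
  have "((\<lambda>s. x s - x t) has_vector_derivative u t - \<beta> *\<^sub>R \<xi>) (at t)"
    using has_vector_derivative_diff[OF x has_vector_derivative_const[of "x t"]] by simp
  then have "((\<lambda>s. \<xi> \<bullet> (x s - x t)) has_real_derivative \<xi> \<bullet> (u t - \<beta> *\<^sub>R \<xi>)) (at t)"
    unfolding has_real_derivative_iff_has_vector_derivative
    by (rule bounded_linear.has_vector_derivative[OF bounded_linear_inner_right])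
  from DERIV_add[OF DERIV_const[of "f t"] this]
  have g: "(g has_real_derivative \<xi> \<bullet> (u t - \<beta> *\<^sub>R \<xi>)) (at t)"
    unfolding g_def by simp
  have gt: "g t = f t" by (simp add: g_def)
  have "energy \<alpha> \<beta> z x u g \<mu> s \<le> energy \<alpha> \<beta> z x u f \<mu> s" if "s \<in> {T..t}" for s
    using that assms(1,3) f[of s] unfolding energy_def g_def
    by (intro add_right_mono mult_left_mono) auto
  moreover have "energy \<alpha> \<beta> z x u g \<mu> t = energy \<alpha> \<beta> z x u f \<mu> t" by (simp add: energy_def gt)
  moreover have "0 < t" using assms by simp
  ultimately show ?thesis
    unfolding left_support_def
    using energy_has_real_derivative[OF \<open>0 < t\<close> x u g, of z \<mu>] unfolding gt by blast
qed

lemma abs_continuous_on_energy: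
  assumes "abs_continuous_on {a..b} x" "abs_continuous_on {a..b} u" "abs_continuous_on {a..b} f"
  shows "abs_continuous_on {a..b} (energy \<alpha> \<beta> z x u f \<mu>)"
  unfolding energy_def
  by (intro abs_continuous_on_add abs_continuous_on_mult abs_continuous_on_norm_square
      abs_continuous_on_diff abs_continuous_on_scaleR abs_continuous_on_const
      abs_continuous_on_ident assms compact_Icc)

text \<open>For \<open>\<mu> = 0\<close> the point \<open>z\<close> drops out. Once
  \<open>t \<ge> 2 * \<beta> * \<alpha>\<close>, the weight
  \<open>t * (t - \<beta> * \<alpha>)\<close> is at least half of \<open>t\<^sup>2\<close>, so the
  energy controls both remaining terms.\<close>

lemma energy_zero_asymptotics:
  fixes x u :: "real \<Rightarrow> 'a::real_inner"
  assumes "(energy \<alpha> \<beta> z x u f 0 \<longlongrightarrow> 0) at_top" and nonneg: "\<And>t. T \<le> t \<Longrightarrow> 0 \<le> f t"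
  shows "((\<lambda>t. t\<^sup>2 * f t) \<longlongrightarrow> 0) at_top" and "((\<lambda>t. t * norm (u t)) \<longlongrightarrow> 0) at_top"
proof -
  let ?G = "energy \<alpha> \<beta> z x u f 0"
  have ev: "\<forall>\<^sub>F t in at_top. T \<le> t \<and> 0 \<le> t \<and> 2 * \<beta> * \<alpha> \<le> t"
    using eventually_ge_at_top[of T] eventually_ge_at_top[of 0] eventually_ge_at_top[of "2 * \<beta> * \<alpha>"]
    by eventually_elim simp
  have G: "?G t = t * (t - \<beta> * \<alpha>) * f t + 1/2 * (t * norm (u t))\<^sup>2" if "0 \<le> t" for t
    using that by (simp add: energy_def)
  have bound: "t\<^sup>2 * f t \<le> 2 * ?G t" "(t * norm (u t))\<^sup>2 \<le> 2 * ?G t"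
    if t: "T \<le> t" "0 \<le> t" "2 * \<beta> * \<alpha> \<le> t" for t
  proof -
    have "t / 2 \<le> t - \<beta> * \<alpha>" using t by simp
    moreover have "0 \<le> t * f t" using t nonneg by simp
    ultimately have "t * f t * (t / 2) \<le> t * f t * (t - \<beta> * \<alpha>)" by (intro mult_left_mono)
    moreover have "0 \<le> t * f t * (t / 2)" using \<open>0 \<le> t * f t\<close> t by simp
    ultimately have "0 \<le> t * (t - \<beta> * \<alpha>) * f t" "t\<^sup>2 * f t \<le> 2 * (t * (t - \<beta> * \<alpha>) * f t)"
      by (simp_all add: power2_eq_square algebra_simps)
    then show "t\<^sup>2 * f t \<le> 2 * ?G t" "(t * norm (u t))\<^sup>2 \<le> 2 * ?G t"
      using G[OF t(2)] zero_le_power2[of "t * norm (u t)"] by linarith+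
  qed
  have lim: "((\<lambda>t. 2 * ?G t) \<longlongrightarrow> 0) at_top" using tendsto_mult_right_zero[OF assms(1)] .
  show "((\<lambda>t. t\<^sup>2 * f t) \<longlongrightarrow> 0) at_top"
  proof (rule tendsto_sandwich[OF _ _ tendsto_const lim])
    show "\<forall>\<^sub>F t in at_top. 0 \<le> t\<^sup>2 * f t" using ev by eventually_elim (simp add: nonneg)
    show "\<forall>\<^sub>F t in at_top. t\<^sup>2 * f t \<le> 2 * ?G t"
      using ev by eventually_elim (intro bound; simp)
  qed
  have "((\<lambda>t. (t * norm (u t))\<^sup>2) \<longlongrightarrow> 0) at_top"
  proof (rule tendsto_sandwich[OF _ _ tendsto_const lim])
    show "\<forall>\<^sub>F t in at_top. (t * norm (u t))\<^sup>2 \<le> 2 * ?G t"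
      using ev by eventually_elim (intro bound; simp)
  qed simp
  then show "((\<lambda>t. t * norm (u t)) \<longlongrightarrow> 0) at_top" by simp
qed

text \<open>The argument sees \<phi> only through \<open>f\<close>:
  \<open>f t \<le> \<xi> \<bullet> (x t - z)\<close> is the subgradient inequality tested at the
  minimiser, the last condition the one tested along the curve.\<close>

lemma energy_zero_tendsto_zero:
  fixes x u :: "real \<Rightarrow> 'a::real_inner" and f :: "real \<Rightarrow> real"
  assumes "\<alpha> > 3" "\<beta> > 0" "t0 > 0"
    and ACx: "\<And>a b. t0 < a \<Longrightarrow> abs_continuous_on {a..b} x"
    and ACu: "\<And>a b. t0 < a \<Longrightarrow> abs_continuous_on {a..b} u"
    and ACf: "\<And>a b. t0 < a \<Longrightarrow> abs_continuous_on {a..b} f"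
    and nonneg: "\<And>t. t0 < t \<Longrightarrow> 0 \<le> f t"
    and AE: "AE t in lebesgue. t > t0 \<longrightarrow> (\<exists>\<xi>. (x has_vector_derivative u t - \<beta> *\<^sub>R \<xi>) (at t) \<and>
        (u has_vector_derivative - (\<alpha> / t) *\<^sub>R (u t - \<beta> *\<^sub>R \<xi>) - \<xi>) (at t) \<and>
        f t \<le> \<xi> \<bullet> (x t - z) \<and> (\<forall>s>t0. f t + \<xi> \<bullet> (x s - x t) \<le> f s))"
  shows "(energy \<alpha> \<beta> z x u f 0 \<longlongrightarrow> 0) at_top"
proof -
  \<comment> \<open>With \<open>\<mu> = 2 + \<delta>\<close> both leading coefficients in the
    derivative of the energy equal \<open>- \<delta> * t\<close>: for \<open>f\<close> through
    \<open>2 - \<mu>\<close>, for the square of \<open>u\<close> through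
    \<open>\<alpha> - 1 - \<mu> = \<delta>\<close>.\<close>
  define \<delta> where "\<delta> = (\<alpha> - 3) / 2"
  have "\<delta> > 0" using \<open>\<alpha> > 3\<close> by (simp add: \<delta>_def)
  have \<alpha>: "\<alpha> = 3 + 2 * \<delta>" by (simp add: \<delta>_def field_simps)
  \<comment> \<open>Each summand secures a threshold: \<open>2 * (\<beta> / \<delta>)\<close>
    absorbs the lower-order term \<open>\<beta> * f t\<close> at the cost of half the decay rate,
    \<open>\<beta> * \<alpha>\<close> makes the weights of the gap nonnegative, and
    \<open>\<beta>\<close> the factor \<open>t - \<beta>\<close>.\<close>
  define T where "T = t0 + 2 * (\<beta> / \<delta>) + \<beta> * \<alpha> + \<beta>"
  have pos: "0 < \<beta> / \<delta>" "0 < \<beta> * \<alpha>" using assms \<open>\<delta> > 0\<close> by auto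
  then have T: "t0 < T" "2 * (\<beta> / \<delta>) \<le> T" "\<beta> \<le> T" "\<beta> * \<alpha> \<le> T" "0 < T"
    using assms(2,3) unfolding T_def by linarith+
  let ?G = "energy \<alpha> \<beta> z x u f 0" and ?E = "energy \<alpha> \<beta> z x u f (2 + \<delta>)"
  define q where "q t = f t + (norm (u t))\<^sup>2" for t
  have "\<beta> * (\<alpha> - (2 + \<delta>)) \<le> \<beta> * \<alpha>" using \<open>\<beta> > 0\<close> \<open>\<delta> > 0\<close> by (intro mult_left_mono) auto
  then have T': "\<beta> * (\<alpha> - (2 + \<delta>)) \<le> T" "\<beta> * (\<alpha> - 0) \<le> T" using T by auto
  have energy_nonneg: "0 \<le> ?G t" "0 \<le> ?E t" if "T \<le> t" for t
  proof -
    have "0 \<le> f t" "0 < t" using nonneg[of t] T that by auto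
    then show "0 \<le> ?G t" "0 \<le> ?E t"
      using T T' that \<open>\<delta> > 0\<close> unfolding energy_def
      by (auto simp: \<alpha> intro!: add_nonneg_nonneg mult_nonneg_nonneg)
  qed
  \<comment> \<open>Both slopes come from the same subgradient and are measured against
    \<open>t * q t\<close>, so that the decay of \<open>?E\<close> can pay for a growth of
    \<open>?G\<close>.\<close>
  have support: "AE t in lebesgue. t \<ge> T \<longrightarrow> (\<exists>d e. left_support T ?G t d \<and> left_support T ?E t e \<and>
      d \<le> 2 * t * q t \<and> e \<le> - (\<delta> / 2) * t * q t)"
    using AE
  proof (eventually_elim, intro impI)
    fix t assume *: "t > t0 \<longrightarrow> (\<exists>\<xi>. (x has_vector_derivative u t - \<beta> *\<^sub>R \<xi>) (at t) \<and>
        (u has_vector_derivative - (\<alpha> / t) *\<^sub>R (u t - \<beta> *\<^sub>R \<xi>) - \<xi>) (at t) \<and>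
        f t \<le> \<xi> \<bullet> (x t - z) \<and> (\<forall>s>t0. f t + \<xi> \<bullet> (x s - x t) \<le> f s))" and t: "T \<le> t"
    then obtain \<xi> where x: "(x has_vector_derivative u t - \<beta> *\<^sub>R \<xi>) (at t)"
      and u: "(u has_vector_derivative - (\<alpha> / t) *\<^sub>R (u t - \<beta> *\<^sub>R \<xi>) - \<xi>) (at t)"
      and z: "f t \<le> \<xi> \<bullet> (x t - z)" and f: "\<And>s. T \<le> s \<Longrightarrow> f t + \<xi> \<bullet> (x s - x t) \<le> f s"
      using T(1) by force
    let ?d = "\<lambda>\<mu>. (2 * t - \<beta> * (\<alpha> - \<mu>)) * f t - \<beta> * t * (t - \<beta> * (\<alpha> - \<mu>)) * (norm \<xi>)\<^sup>2
      - \<mu> * (t - \<beta>) * (\<xi> \<bullet> (x t - z)) - (\<alpha> - 1 - \<mu>) * t * (norm (u t))\<^sup>2"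
    have ft: "0 \<le> f t" and "0 < t" using nonneg T t by auto
    have drop: "0 \<le> \<beta> * t * (t - \<beta> * (\<alpha> - \<mu>)) * (norm \<xi>)\<^sup>2" if "\<beta> * (\<alpha> - \<mu>) \<le> T" for \<mu>
      using that t \<open>0 < t\<close> \<open>\<beta> > 0\<close> by simp
    \<comment> \<open>The factor \<open>\<alpha> + 1\<close> is the 2 of the target bound plus the
      \<open>\<alpha> - 1\<close> already present in \<open>?d 0\<close>.\<close>
    have "0 \<le> \<beta> * \<alpha> * f t" "0 \<le> (\<alpha> + 1) * (t * (norm (u t))\<^sup>2)"
      using pos(2) ft \<open>0 < t\<close> \<open>\<alpha> > 3\<close> by auto
    then have d: "?d 0 \<le> 2 * t * q t"
      using drop[OF T'(2)] by (simp add: q_def algebra_simps)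
    have "(2 + \<delta>) * (t - \<beta>) * f t \<le> (2 + \<delta>) * (t - \<beta>) * (\<xi> \<bullet> (x t - z))"
      using z t T \<open>\<delta> > 0\<close> by (intro mult_left_mono) auto
    then have "?d (2 + \<delta>) \<le> (2 * t - \<beta> * (\<alpha> - (2 + \<delta>))) * f t - (2 + \<delta>) * (t - \<beta>) * f t
        - (\<alpha> - 1 - (2 + \<delta>)) * t * (norm (u t))\<^sup>2"
      using drop[OF T'(1)] by linarith
    also have "\<dots> = (\<beta> - \<delta> * t) * f t - \<delta> * (t * (norm (u t))\<^sup>2)"
      by (simp add: \<alpha> algebra_simps)
    also have "\<dots> \<le> (- (\<delta> / 2) * t) * f t - (\<delta> / 2) * (t * (norm (u t))\<^sup>2)"
    proof -
      have "2 * \<beta> \<le> t * \<delta>" using mult_right_mono[of "2 * (\<beta> / \<delta>)" t \<delta>] T(2) t \<open>\<delta> > 0\<close> by simp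
      then have "(\<beta> - \<delta> * t) * f t \<le> (- (\<delta> / 2) * t) * f t"
        using ft by (intro mult_right_mono) (auto simp: mult.commute)
      moreover have "(\<delta> / 2) * (t * (norm (u t))\<^sup>2) \<le> \<delta> * (t * (norm (u t))\<^sup>2)"
        using \<open>0 < t\<close> \<open>\<delta> > 0\<close> by (intro mult_right_mono) auto
      ultimately show ?thesis by linarith
    qed
    also have "\<dots> = - (\<delta> / 2) * t * q t" by (simp add: q_def algebra_simps)
    finally have e: "?d (2 + \<delta>) \<le> - (\<delta> / 2) * t * q t" .
    show "\<exists>d e. left_support T ?G t d \<and> left_support T ?E t e \<and> d \<le> 2 * t * q t \<and> e \<le> - (\<delta> / 2) * t * q t"
      using energy_left_support[OF T(5) t T'(2) x u f] energy_left_support[OF T(5) t T'(1) x u f] d e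
      by blast
  qed
  have q_nonneg: "0 \<le> t * q t" if "T \<le> t" for t
    using nonneg[of t] T that by (auto simp: q_def)
  have AC: "abs_continuous_on {s..t} ?G" "abs_continuous_on {s..t} ?E" if "T \<le> s" for s t
    using that T(1) by (auto intro!: abs_continuous_on_energy ACx ACu ACf)
  have E_anti: "?E t \<le> ?E s" if st: "T \<le> s" "s \<le> t" for s t
  proof (rule abs_continuous_on_nonincreasing[OF st(2) AC(2)[OF st(1)]])
    show "AE r in lebesgue. r \<in> {s<..<t} \<longrightarrow> (\<exists>d\<le>0. left_support s ?E r d)"
      using support
    proof (eventually_elim, intro impI)
      fix r assume *: "T \<le> r \<longrightarrow> (\<exists>d e. left_support T ?G r d \<and> left_support T ?E r e \<and>
          d \<le> 2 * r * q r \<and> e \<le> - (\<delta> / 2) * r * q r)" and "r \<in> {s<..<t}"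
      then have "T \<le> r" using st by auto
      then obtain e where "left_support T ?E r e" "e \<le> - (\<delta> / 2) * r * q r" using * by blast
      moreover have "- (\<delta> / 2) * r * q r \<le> 0"
        using q_nonneg[OF \<open>T \<le> r\<close>] \<open>\<delta> > 0\<close> by (simp add: mult.assoc mult_nonneg_nonneg)
      ultimately show "\<exists>d\<le>0. left_support s ?E r d"
        using left_support_antimono[OF _ st(1)] by (meson order_trans)
    qed
  qed
  \<comment> \<open>The factor \<open>4 / \<delta>\<close> turns the decay rate
    \<open>\<delta> / 2\<close> of \<open>?E\<close> into exactly the 2 that bounds the growth of
    \<open>?G\<close>.\<close>
  let ?H = "\<lambda>t. ?G t + 4 / \<delta> * ?E t"
  have H_anti: "?H t \<le> ?H s" if st: "T \<le> s" "s \<le> t" for s t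
  proof (rule abs_continuous_on_nonincreasing[OF st(2)])
    show "abs_continuous_on {s..t} ?H"
      using AC st(1) by (intro abs_continuous_on_add abs_continuous_on_mult abs_continuous_on_const) auto
    show "AE r in lebesgue. r \<in> {s<..<t} \<longrightarrow> (\<exists>d\<le>0. left_support s ?H r d)"
      using support
    proof (eventually_elim, intro impI)
      fix r assume *: "T \<le> r \<longrightarrow> (\<exists>d e. left_support T ?G r d \<and> left_support T ?E r e \<and>
          d \<le> 2 * r * q r \<and> e \<le> - (\<delta> / 2) * r * q r)" and "r \<in> {s<..<t}"
      then have "T \<le> r" using st by auto
      then obtain d e where de: "left_support T ?G r d" "left_support T ?E r e"
          "d \<le> 2 * r * q r" "e \<le> - (\<delta> / 2) * r * q r" using * by blast
      have "left_support T ?H r (d + 4 / \<delta> * e)"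
        using de(1,2) \<open>\<delta> > 0\<close> by (intro left_support_add left_support_cmult) auto
      moreover have "4 / \<delta> * e \<le> 4 / \<delta> * (- (\<delta> / 2) * r * q r)"
        using de(4) \<open>\<delta> > 0\<close> by (intro mult_left_mono) auto
      then have "4 / \<delta> * e \<le> - 2 * (r * q r)" using \<open>\<delta> > 0\<close> by (simp add: mult.assoc)
      then have "d + 4 / \<delta> * e \<le> 0" using de(3) by (simp add: mult.assoc)
      ultimately show "\<exists>d\<le>0. left_support s ?H r d"
        using left_support_antimono[OF _ st(1)] by blast
    qed
  qed
  have H_nonneg: "0 \<le> ?H t" if "T \<le> t" for t
    using energy_nonneg[OF that] \<open>\<delta> > 0\<close> by simp
  obtain l where l: "(?E \<longlongrightarrow> l) at_top"
    by (rule antimono_on_bounded_below_convergent[of T ?E, OF E_anti energy_nonneg(2)])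
  obtain m where m: "(?H \<longlongrightarrow> m) at_top"
    by (rule antimono_on_bounded_below_convergent[of T ?H, OF H_anti H_nonneg])
  define L where "L = m - 4 / \<delta> * l"
  \<comment> \<open>\<open>?G\<close> need not be monotone; its limit is recovered from two
    convergent monotone functions.\<close>
  have "((\<lambda>t. ?H t - 4 / \<delta> * ?E t) \<longlongrightarrow> L) at_top"
    unfolding L_def by (intro tendsto_intros l m)
  then have G_lim: "(?G \<longlongrightarrow> L) at_top" by simp
  have "\<forall>\<^sub>F t in at_top. 0 \<le> ?G t"
    using eventually_ge_at_top[of T] by eventually_elim (rule energy_nonneg(1))
  then have "L \<ge> 0" by (rule tendsto_lowerbound[OF G_lim]) simp
  have "L = 0"
  proof (rule ccontr)
    assume "L \<noteq> 0"
    then have "L > 0" using \<open>L \<ge> 0\<close> by simp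
    then have "\<forall>\<^sub>F t in at_top. L / 2 < ?G t" using order_tendstoD(1)[OF G_lim, of "L / 2"] by simp
    then obtain T1 where T1: "\<And>t. T1 \<le> t \<Longrightarrow> L / 2 < ?G t" unfolding eventually_at_top_linorder by blast
    define S where "S = max T T1"
    have S: "T \<le> S" "0 < S" "T1 \<le> S" using T by (auto simp: S_def)
    \<comment> \<open>Product of the rate \<open>\<delta> / 2\<close> and the lower bound
      \<open>L / 2\<close> of \<open>?G\<close>.\<close>
    define c where "c = \<delta> * L / 4"
    have "c > 0" using \<open>\<delta> > 0\<close> \<open>L > 0\<close> by (simp add: c_def)
    have decay: "c / r \<le> (\<delta> / 2) * r * q r" if "S \<le> r" for r
    proof -
      have r: "T \<le> r" "0 < r" using that S by auto
      have "?G r \<le> r\<^sup>2 * q r"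
      proof -
        have "0 \<le> f r" using nonneg T r by simp
        then have "0 \<le> r * (\<beta> * \<alpha>) * f r" using pos(2) r by simp
        moreover have "?G r = r * (r - \<beta> * \<alpha>) * f r + 1/2 * (r\<^sup>2 * (norm (u r))\<^sup>2)"
          using r by (simp add: energy_def power_mult_distrib)
        moreover have "1/2 * (r\<^sup>2 * (norm (u r))\<^sup>2) \<le> r\<^sup>2 * (norm (u r))\<^sup>2" by simp
        ultimately show ?thesis by (simp add: q_def algebra_simps power2_eq_square)
      qed
      then have "L / 2 \<le> r\<^sup>2 * q r" using T1[of r] that S by simp
      then have "\<delta> / 2 * (L / 2) \<le> \<delta> / 2 * (r\<^sup>2 * q r)" using \<open>\<delta> > 0\<close> by (intro mult_left_mono) auto
      then have "c \<le> ((\<delta> / 2) * r * q r) * r" by (simp add: c_def power2_eq_square mult_ac)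
      then show ?thesis using r by (simp add: pos_divide_le_eq)
    qed
    \<comment> \<open>The lower bound on the decay integrates to a logarithm; since
      \<open>?E\<close> is nonnegative, \<open>ln\<close> would be bounded.\<close>
    have "?E t + c * ln t \<le> ?E S + c * ln S" if "S \<le> t" for t
    proof (rule abs_continuous_on_nonincreasing[OF that])
      have "abs_continuous_on {S..t} (\<lambda>t. ln t)"
        using S by (intro abs_continuous_on_C1[where f' = inverse])
          (auto intro!: continuous_intros derivative_eq_intros simp: divide_inverse)
      then show "abs_continuous_on {S..t} (\<lambda>t. ?E t + c * ln t)"
        using AC S by (intro abs_continuous_on_add abs_continuous_on_mult abs_continuous_on_const) auto
      show "AE r in lebesgue. r \<in> {S<..<t} \<longrightarrow> (\<exists>d\<le>0. left_support S (\<lambda>t. ?E t + c * ln t) r d)"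
        using support
      proof (eventually_elim, intro impI)
        fix r assume *: "T \<le> r \<longrightarrow> (\<exists>d e. left_support T ?G r d \<and> left_support T ?E r e \<and>
            d \<le> 2 * r * q r \<and> e \<le> - (\<delta> / 2) * r * q r)" and "r \<in> {S<..<t}"
        then have r: "T \<le> r" "S \<le> r" "0 < r" using S by auto
        then obtain e where e: "left_support T ?E r e" "e \<le> - (\<delta> / 2) * r * q r" using * by blast
        have "((\<lambda>t. c * ln t) has_real_derivative c / r) (at r)"
          using r by (auto intro!: derivative_eq_intros)
        then have "left_support T (\<lambda>t. ?E t + c * ln t) r (e + c / r)"
          by (intro left_support_add[OF e(1)] left_support_derivative)
        moreover have "e + c / r \<le> 0" using decay[OF r(2)] e(2) by linarith
        ultimately show "\<exists>d\<le>0. left_support S (\<lambda>t. ?E t + c * ln t) r d"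
          using left_support_antimono[OF _ S(1)] by blast
      qed
    qed
    then have "ln t \<le> (?E S + c * ln S) / c" if "S \<le> t" for t
      using energy_nonneg(2)[of t] S that \<open>c > 0\<close> by (fastforce simp: pos_le_divide_eq mult.commute)
    moreover have "\<forall>\<^sub>F t::real in at_top. (?E S + c * ln S) / c < ln t"
      using ln_at_top by (simp add: filterlim_at_top_dense)
    then have "\<forall>\<^sub>F t in at_top. S \<le> t \<and> (?E S + c * ln S) / c < ln t"
      using eventually_ge_at_top[of S] by eventually_elim simp
    then obtain t where "S \<le> t" "(?E S + c * ln S) / c < ln t"
      using eventually_happens' trivial_limit_at_top_linorder by blast
    ultimately show False by fastforce
  qed
  then show ?thesis using G_lim by simp
qed

section \<open>Strong solutions\<close>

lemma has_vector_derivative_norm_le_lipschitz: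
  fixes x :: "real \<Rightarrow> 'a::real_normed_vector"
  assumes x: "(x has_vector_derivative v) (at t)" and L: "L-lipschitz_on {a..b} x" and t: "t \<in> {a<..<b}"
  shows "norm v \<le> L"
proof (rule field_le_epsilon)
  fix e :: real assume "e > 0"
  have "(x has_derivative (\<lambda>h. h *\<^sub>R v)) (at t)" using x by (simp add: has_vector_derivative_def)
  then obtain d where d: "d > 0" "\<And>s. norm (s - t) < d \<Longrightarrow>
      norm (x s - x t - (s - t) *\<^sub>R v) \<le> e * norm (s - t)"
    unfolding has_derivative_at_alt using \<open>e > 0\<close> by blast
  define h where "h = min (d / 2) (b - t)"
  have h: "0 < h" "h < d" "t + h \<in> {a..b}" using t d(1) by (auto simp: h_def)
  have "norm (h *\<^sub>R v) \<le> norm (x (t + h) - x t) + norm (x (t + h) - x t - h *\<^sub>R v)"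
    using norm_triangle_ineq4[of "x (t + h) - x t" "x (t + h) - x t - h *\<^sub>R v"] by simp
  also have "\<dots> \<le> L * h + e * h"
    using lipschitz_onD[OF L h(3), of t] d(2)[of "t + h"] h t by (auto simp: dist_norm)
  finally have "norm v * h \<le> (L + e) * h" using h(1) by (simp add: algebra_simps)
  then show "norm v \<le> L + e" using h(1) by simp
qed

text \<open>For the pair of \<open>x\<close> and \<open>y\<close> the velocity is a part that is
  Lipschitz in time and state along the curve, as \<open>c\<close> and \<open>d\<close> are
  Lipschitz and \<open>x\<close> is bounded, minus a subgradient. Monotonicity of the
  subdifferential discards the subgradients and leaves a one-sided estimate.\<close>

lemma coupled_system_lipschitz:
  fixes x y :: "real \<Rightarrow> 'a::real_inner" and c d :: "real \<Rightarrow> real"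
  assumes "proper \<phi>" "\<beta> > 0" "a < a'"
    and ACx: "abs_continuous_on {a..b} x" and ACy: "abs_continuous_on {a..b} y"
    and c: "C-lipschitz_on {a..b} c" and d: "D-lipschitz_on {a..b} d"
    and AE: "AE t in lebesgue. t \<in> {a<..<b} \<longrightarrow> (\<exists>g\<in>subdifferential \<phi> (x t).
      (x has_vector_derivative c t *\<^sub>R x t - (1 / \<beta>) *\<^sub>R y t - \<beta> *\<^sub>R g) (at t) \<and>
      (y has_vector_derivative d t *\<^sub>R x t - (1 / \<beta>) *\<^sub>R y t) (at t))"
  obtains L where "L-lipschitz_on {a'..b} x"
proof -
  define X where "X t = (x t, y t)" for t
  have bounds: "\<exists>B\<ge>0. \<forall>t\<in>{a..b}. norm (f t) \<le> B" if "continuous_on {a..b} f"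
    for f :: "real \<Rightarrow> 'b::real_normed_vector"
  proof -
    have "bounded (f ` {a..b})" using that by (intro compact_imp_bounded compact_continuous_image) auto
    then obtain B where "\<forall>t\<in>{a..b}. norm (f t) \<le> B" unfolding bounded_iff by blast
    then show ?thesis by (intro exI[of _ "max 0 B"]) (auto intro: max.coboundedI2)
  qed
  obtain R where R: "R \<ge> 0" "\<forall>t\<in>{a..b}. norm (x t) \<le> R"
    using bounds[OF abs_continuous_on_imp_continuous_on[OF ACx]] by blast
  have scaled: "\<exists>A\<ge>0. \<exists>B\<ge>0. \<forall>s\<in>{a..b}. \<forall>t\<in>{a..b}.
      norm (e t *\<^sub>R x t - e s *\<^sub>R x s) \<le> A * norm (X t - X s) + B * \<bar>t - s\<bar>"
    if e: "E-lipschitz_on {a..b} e" for e :: "real \<Rightarrow> real" and E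
  proof -
    obtain A where A: "A \<ge> 0" "\<forall>t\<in>{a..b}. norm (e t) \<le> A"
      using bounds[OF lipschitz_on_continuous_on[OF e]] by blast
    have E: "0 \<le> E" using lipschitz_on_nonneg[OF e] .
    have "norm (e t *\<^sub>R x t - e s *\<^sub>R x s) \<le> A * norm (X t - X s) + (E * R) * \<bar>t - s\<bar>"
      if st: "s \<in> {a..b}" "t \<in> {a..b}" for s t
    proof -
      have "e t *\<^sub>R x t - e s *\<^sub>R x s = e t *\<^sub>R (x t - x s) + (e t - e s) *\<^sub>R x s"
        by (simp add: algebra_simps)
      then have "norm (e t *\<^sub>R x t - e s *\<^sub>R x s) \<le> \<bar>e t\<bar> * norm (x t - x s) + \<bar>e t - e s\<bar> * norm (x s)"
        by (metis norm_scaleR norm_triangle_ineq)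
      also have "\<dots> \<le> A * norm (X t - X s) + (E * \<bar>t - s\<bar>) * R"
        using A R E st lipschitz_onD[OF e, of t s] norm_fst_le[of "x t - x s" "y t - y s"]
        by (intro add_mono mult_mono) (auto simp: X_def dist_real_def)
      finally show ?thesis by (simp add: mult_ac)
    qed
    then show ?thesis using A(1) E R(1) by (meson mult_nonneg_nonneg)
  qed
  obtain A1 B1 where AB1: "A1 \<ge> 0" "B1 \<ge> 0" "\<And>s t. s \<in> {a..b} \<Longrightarrow> t \<in> {a..b} \<Longrightarrow>
      norm (c t *\<^sub>R x t - c s *\<^sub>R x s) \<le> A1 * norm (X t - X s) + B1 * \<bar>t - s\<bar>" using scaled[OF c] by blast
  obtain A2 B2 where AB2: "A2 \<ge> 0" "B2 \<ge> 0" "\<And>s t. s \<in> {a..b} \<Longrightarrow> t \<in> {a..b} \<Longrightarrow>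
      norm (d t *\<^sub>R x t - d s *\<^sub>R x s) \<le> A2 * norm (X t - X s) + B2 * \<bar>t - s\<bar>" using scaled[OF d] by blast
  define G where "G t \<longleftrightarrow> (\<exists>g\<in>subdifferential \<phi> (x t).
      (x has_vector_derivative c t *\<^sub>R x t - (1 / \<beta>) *\<^sub>R y t - \<beta> *\<^sub>R g) (at t) \<and>
      (y has_vector_derivative d t *\<^sub>R x t - (1 / \<beta>) *\<^sub>R y t) (at t))" for t
  \<comment> \<open>The derivative itself serves as velocity, so it does not depend on which
    subgradient witnesses \<open>G t\<close>.\<close>
  define V where "V t = vector_derivative X (at t)" for t
  have G: "\<exists>g\<in>subdifferential \<phi> (x t). (X has_vector_derivative V t) (at t) \<and>
      V t = (c t *\<^sub>R x t - (1 / \<beta>) *\<^sub>R y t - \<beta> *\<^sub>R g, d t *\<^sub>R x t - (1 / \<beta>) *\<^sub>R y t)" if "G t" for t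
  proof -
    obtain g where g: "g \<in> subdifferential \<phi> (x t)"
      and gx: "(x has_vector_derivative c t *\<^sub>R x t - (1 / \<beta>) *\<^sub>R y t - \<beta> *\<^sub>R g) (at t)"
      and gy: "(y has_vector_derivative d t *\<^sub>R x t - (1 / \<beta>) *\<^sub>R y t) (at t)"
      using \<open>G t\<close> unfolding G_def by blast
    have "(X has_vector_derivative
        (c t *\<^sub>R x t - (1 / \<beta>) *\<^sub>R y t - \<beta> *\<^sub>R g, d t *\<^sub>R x t - (1 / \<beta>) *\<^sub>R y t)) (at t)"
      unfolding X_def using gx gy by (rule has_vector_derivative_Pair)
    then show ?thesis unfolding V_def using g vector_derivative_at by metis
  qed
  \<comment> \<open>The half comes from \<open>h * N \<le> (N\<^sup>2 + h\<^sup>2) / 2\<close> for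
    the mixed terms, \<open>1 / \<beta>\<close> from the coupling of \<open>y\<close> into the
    equation for \<open>x\<close>.\<close>
  define K where "K = A1 + A2 + (B1 + B2) / 2 + 1 / \<beta>"
  have velocity: "(V t - V s) \<bullet> (X t - X s) \<le> K * ((norm (X t - X s))\<^sup>2 + (t - s)\<^sup>2)"
    if st: "s \<in> {a<..<b}" "t \<in> {a<..<b}" "G s" "G t" for s t
  proof -
    obtain g where g: "g \<in> subdifferential \<phi> (x s)"
      "V s = (c s *\<^sub>R x s - (1 / \<beta>) *\<^sub>R y s - \<beta> *\<^sub>R g, d s *\<^sub>R x s - (1 / \<beta>) *\<^sub>R y s)"
      using G[OF st(3)] by blast
    obtain g' where g': "g' \<in> subdifferential \<phi> (x t)"
      "V t = (c t *\<^sub>R x t - (1 / \<beta>) *\<^sub>R y t - \<beta> *\<^sub>R g', d t *\<^sub>R x t - (1 / \<beta>) *\<^sub>R y t)"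
      using G[OF st(4)] by blast
    define p q N h where "p = x t - x s" and "q = y t - y s" and "N = norm (X t - X s)" and "h = \<bar>t - s\<bar>"
    let ?C = "c t *\<^sub>R x t - c s *\<^sub>R x s" and ?D = "d t *\<^sub>R x t - d s *\<^sub>R x s"
    have N: "norm p \<le> N" "norm q \<le> N" "0 \<le> N"
      using norm_fst_le[of p q] norm_snd_le[of q p] by (auto simp: N_def p_def q_def X_def)
    have "(V t - V s) \<bullet> (X t - X s)
        = ?C \<bullet> p + ?D \<bullet> q - (1 / \<beta>) * (q \<bullet> p) - (1 / \<beta>) * (q \<bullet> q) - \<beta> * ((g' - g) \<bullet> p)"
      unfolding g(2) g'(2) X_def p_def q_def
      by (simp add: inner_diff_left inner_diff_right algebra_simps)
    \<comment> \<open>The damping of \<open>y\<close> and the monotone subgradient term both have a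
      favourable sign.\<close>
    also have "\<dots> \<le> ?C \<bullet> p + ?D \<bullet> q - (1 / \<beta>) * (q \<bullet> p)"
    proof -
      have "0 \<le> (1 / \<beta>) * (q \<bullet> q)" "0 \<le> \<beta> * ((g' - g) \<bullet> p)"
        using subdifferential_monotone[OF assms(1) g'(1) g(1)] \<open>\<beta> > 0\<close> by (simp_all add: p_def)
      then show ?thesis by linarith
    qed
    also have "\<dots> \<le> (A1 * N + B1 * h) * N + (A2 * N + B2 * h) * N + (1 / \<beta>) * (N * N)"
    proof -
      have "?C \<bullet> p \<le> norm ?C * norm p" "?D \<bullet> q \<le> norm ?D * norm q" by (rule norm_cauchy_schwarz)+
      moreover have "norm ?C * norm p \<le> (A1 * N + B1 * h) * N"
        using AB1(3)[of s t] AB1(1,2) st N by (intro mult_mono) (auto simp: N_def h_def)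
      moreover have "norm ?D * norm q \<le> (A2 * N + B2 * h) * N"
        using AB2(3)[of s t] AB2(1,2) st N by (intro mult_mono) (auto simp: N_def h_def)
      moreover have "- (q \<bullet> p) \<le> N * N"
      proof -
        have "\<bar>q \<bullet> p\<bar> \<le> norm q * norm p" by (rule Cauchy_Schwarz_ineq2)
        also have "\<dots> \<le> N * N" using N by (intro mult_mono) auto
        finally show ?thesis by simp
      qed
      then have "(1 / \<beta>) * - (q \<bullet> p) \<le> (1 / \<beta>) * (N * N)" using \<open>\<beta> > 0\<close> by (intro mult_left_mono) auto
      ultimately show ?thesis by linarith
    qed
    also have "\<dots> = (A1 + A2 + 1 / \<beta>) * N\<^sup>2 + (B1 + B2) * (h * N)"
      by (simp add: power2_eq_square algebra_simps)
    also have "\<dots> \<le> (A1 + A2 + 1 / \<beta>) * (N\<^sup>2 + h\<^sup>2) + (B1 + B2) * ((N\<^sup>2 + h\<^sup>2) / 2)"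
    proof -
      have "h * N \<le> (N\<^sup>2 + h\<^sup>2) / 2" using zero_le_power2[of "N - h"] by (simp add: power2_diff algebra_simps)
      then show ?thesis using AB1 AB2 \<open>\<beta> > 0\<close> by (intro add_mono mult_left_mono) auto
    qed
    also have "\<dots> = K * (N\<^sup>2 + h\<^sup>2)" by (simp add: K_def algebra_simps add_divide_distrib)
    finally show ?thesis by (simp add: N_def h_def)
  qed
  obtain L where "L-lipschitz_on {a'..b} X"
  proof (rule one_sided_lipschitz_velocity_imp_lipschitz[of a b X a' G V K])
    show "abs_continuous_on {a..b} X" unfolding X_def by (rule abs_continuous_on_Pair[OF ACx ACy])
    show "AE t in lebesgue. t \<in> {a<..<b} \<longrightarrow> G t" using AE by (simp add: G_def)
    show "(X has_vector_derivative V t) (at t)" if "G t" for t using G[OF that] by blast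
  qed (use velocity \<open>a < a'\<close> in auto)
  then have "L-lipschitz_on {a'..b} x"
    using dist_fst_le[of "X s" "X t" for s t] unfolding lipschitz_on_def X_def fst_conv
    by (meson order_trans)
  then show ?thesis by (rule that)
qed

text \<open>The solution notion allows a separate null set for each horizon; countably many horizons
  \<open>t0 + real (Suc n)\<close> exhaust the half-line with a single one. \<open>Suc\<close> keeps
  each of them beyond \<open>t0\<close>.\<close>

lemma global_strong_solution_AE:
  assumes "global_strong_solution \<phi> \<alpha> \<beta> t0 x y"
  shows "AE t in lebesgue. t0 < t \<longrightarrow> (\<exists>g\<in>subdifferential \<phi> (x t).
      (x has_vector_derivative (1 / \<beta> - \<alpha> / t) *\<^sub>R x t - (1 / \<beta>) *\<^sub>R y t - \<beta> *\<^sub>R g) (at t) \<and>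
      (y has_vector_derivative (1 / \<beta> - \<alpha> / t + \<alpha> * \<beta> / t\<^sup>2) *\<^sub>R x t - (1 / \<beta>) *\<^sub>R y t) (at t))"
proof -
  let ?x = "\<lambda>t. \<exists>x' g. (x has_vector_derivative x') (at t) \<and> g \<in> subdifferential \<phi> (x t) \<and>
      x' + \<beta> *\<^sub>R g - (1 / \<beta> - \<alpha> / t) *\<^sub>R x t + (1 / \<beta>) *\<^sub>R y t = 0"
  let ?y = "\<lambda>t. \<exists>y'. (y has_vector_derivative y') (at t) \<and>
      y' - (1 / \<beta> - \<alpha> / t + \<alpha> * \<beta> / t\<^sup>2) *\<^sub>R x t + (1 / \<beta>) *\<^sub>R y t = 0"
  have "AE t in lebesgue. t \<in> {t0<..t0 + real (Suc n)} \<longrightarrow> ?x t"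
    and "AE t in lebesgue. t \<in> {t0<..t0 + real (Suc n)} \<longrightarrow> ?y t" for n :: nat
    using assms unfolding global_strong_solution_def by (auto dest!: spec[of _ "t0 + real (Suc n)"])
  then have "AE t in lebesgue. \<forall>n. t \<in> {t0<..t0 + real (Suc n)} \<longrightarrow> ?x t"
    and "AE t in lebesgue. \<forall>n. t \<in> {t0<..t0 + real (Suc n)} \<longrightarrow> ?y t"
    by (simp_all only: AE_all_countable simp_thms)
  then show ?thesis
  proof (eventually_elim, intro impI)
    fix t assume x: "\<forall>n. t \<in> {t0<..t0 + real (Suc n)} \<longrightarrow> ?x t"
      and y: "\<forall>n. t \<in> {t0<..t0 + real (Suc n)} \<longrightarrow> ?y t" and "t0 < t"
    obtain n where "t - t0 < real n" using reals_Archimedean2 by blast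
    then have n: "t \<in> {t0<..t0 + real (Suc n)}" using \<open>t0 < t\<close> by simp
    obtain x' g where g: "(x has_vector_derivative x') (at t)" "g \<in> subdifferential \<phi> (x t)"
        "x' + \<beta> *\<^sub>R g - (1 / \<beta> - \<alpha> / t) *\<^sub>R x t + (1 / \<beta>) *\<^sub>R y t = 0" using x n by blast
    obtain y' where y': "(y has_vector_derivative y') (at t)"
        "y' - (1 / \<beta> - \<alpha> / t + \<alpha> * \<beta> / t\<^sup>2) *\<^sub>R x t + (1 / \<beta>) *\<^sub>R y t = 0" using y n by blast
    have "x' - ((1 / \<beta> - \<alpha> / t) *\<^sub>R x t - (1 / \<beta>) *\<^sub>R y t - \<beta> *\<^sub>R g) = 0"
      unfolding g(3)[symmetric] by (simp only: diff_diff_eq2 diff_add_eq diff_diff_eq add_diff_eq ac_simps)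
    moreover have "y' - ((1 / \<beta> - \<alpha> / t + \<alpha> * \<beta> / t\<^sup>2) *\<^sub>R x t - (1 / \<beta>) *\<^sub>R y t) = 0"
      unfolding y'(2)[symmetric] by (simp only: diff_diff_eq2 diff_add_eq)
    ultimately show "\<exists>g\<in>subdifferential \<phi> (x t).
      (x has_vector_derivative (1 / \<beta> - \<alpha> / t) *\<^sub>R x t - (1 / \<beta>) *\<^sub>R y t - \<beta> *\<^sub>R g) (at t) \<and>
      (y has_vector_derivative (1 / \<beta> - \<alpha> / t + \<alpha> * \<beta> / t\<^sup>2) *\<^sub>R x t - (1 / \<beta>) *\<^sub>R y t) (at t)"
      using g(1,2) y'(1) unfolding right_minus_eq by blast
  qed
qed

lemma global_strong_solution_abs_continuous_on:
  assumes "global_strong_solution \<phi> \<alpha> \<beta> t0 x y" "t0 < a"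
  shows "abs_continuous_on {a..b} x" "abs_continuous_on {a..b} y"
proof -
  \<comment> \<open>The horizon has to exceed \<open>t0\<close> even when \<open>b\<close> does
    not.\<close>
  have "{a..b} \<subseteq> {t0<..max b (t0 + 1)}" using \<open>t0 < a\<close> by auto
  moreover have "t0 < max b (t0 + 1)" by simp
  ultimately show "abs_continuous_on {a..b} x" "abs_continuous_on {a..b} y"
    using assms(1) compact_Icc[of a b] unfolding global_strong_solution_def by blast+
qed

text \<open>Away from \<open>t0\<close> the solution is Lipschitz, so its velocity is bounded; the
  equation then bounds the subgradient by the velocity and the continuous remainder
  \<open>?u\<close>.\<close>

lemma global_strong_solution_regularity:
  assumes "proper \<phi>" "lower_semicontinuous \<phi>" "\<beta> > 0" "t0 > 0"
    and sol: "global_strong_solution \<phi> \<alpha> \<beta> t0 x y" and "t0 < a"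
  shows "\<forall>t\<in>{a..b}. \<phi> (x t) \<noteq> \<infinity>"
    and "abs_continuous_on {a..b} (\<lambda>t. real_of_ereal (\<phi> (x t)))"
proof -
  \<comment> \<open>\<open>b'\<close> makes the interval nondegenerate, and \<open>a0\<close> leaves
    room between \<open>t0\<close> and \<open>a\<close> for the starting time of the Lipschitz
    estimate.\<close>
  define b' where "b' = max b (a + 1)"
  define a0 where "a0 = (t0 + a) / 2"
  have ab: "a < b'" "b \<le> b'" "t0 < a0" "a0 < a" "0 < a0" using assms by (auto simp: b'_def a0_def)
  let ?c = "\<lambda>t. 1 / \<beta> - \<alpha> / t" and ?d = "\<lambda>t. 1 / \<beta> - \<alpha> / t + \<alpha> * \<beta> / t\<^sup>2"
  let ?u = "\<lambda>t. (1 / \<beta> - \<alpha> / t) *\<^sub>R x t - (1 / \<beta>) *\<^sub>R y t"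
  note AC = global_strong_solution_abs_continuous_on[OF sol]
  note AE = global_strong_solution_AE[OF sol]
  obtain C where C: "C-lipschitz_on {a0..b'} ?c"
    by (rule C1_imp_lipschitz_on[of a0 b' ?c "\<lambda>t. \<alpha> / t\<^sup>2"])
      (use ab in \<open>auto intro!: derivative_eq_intros continuous_intros simp: power2_eq_square\<close>)
  obtain D where D: "D-lipschitz_on {a0..b'} ?d"
    by (rule C1_imp_lipschitz_on[of a0 b' ?d "\<lambda>t. \<alpha> / t\<^sup>2 - 2 * \<alpha> * \<beta> / t ^ 3"])
      (use ab in \<open>auto intro!: derivative_eq_intros continuous_intros simp: field_simps power2_eq_square power3_eq_cube\<close>)
  have AE': "AE t in lebesgue. t \<in> {a0<..<b'} \<longrightarrow> (\<exists>g\<in>subdifferential \<phi> (x t).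
      (x has_vector_derivative ?c t *\<^sub>R x t - (1 / \<beta>) *\<^sub>R y t - \<beta> *\<^sub>R g) (at t) \<and>
      (y has_vector_derivative ?d t *\<^sub>R x t - (1 / \<beta>) *\<^sub>R y t) (at t))"
    using AE
  proof (rule eventually_mono, intro impI)
    fix t assume *: "t0 < t \<longrightarrow> (\<exists>g\<in>subdifferential \<phi> (x t).
      (x has_vector_derivative ?c t *\<^sub>R x t - (1 / \<beta>) *\<^sub>R y t - \<beta> *\<^sub>R g) (at t) \<and>
      (y has_vector_derivative ?d t *\<^sub>R x t - (1 / \<beta>) *\<^sub>R y t) (at t))" and "t \<in> {a0<..<b'}"
    then show "\<exists>g\<in>subdifferential \<phi> (x t).
      (x has_vector_derivative ?c t *\<^sub>R x t - (1 / \<beta>) *\<^sub>R y t - \<beta> *\<^sub>R g) (at t) \<and>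
      (y has_vector_derivative ?d t *\<^sub>R x t - (1 / \<beta>) *\<^sub>R y t) (at t)"
      using ab by (intro *[THEN mp]) auto
  qed
  obtain L where L: "L-lipschitz_on {a..b'} x"
    by (rule coupled_system_lipschitz[OF assms(1,3) ab(4) AC[OF ab(3)] C D AE'])
  have "continuous_on {a..b'} ?u"
    using AC[OF \<open>t0 < a\<close>, of b', THEN abs_continuous_on_imp_continuous_on] assms(4,6)
    by (auto intro!: continuous_intros)
  then have "bounded (?u ` {a..b'})" by (intro compact_imp_bounded compact_continuous_image) auto
  then obtain B where B: "\<And>t. t \<in> {a..b'} \<Longrightarrow> norm (?u t) \<le> B" unfolding bounded_iff by blast
  have "AE t in lebesgue. t \<in> {a<..<b'} \<longrightarrow> (\<exists>g\<in>subdifferential \<phi> (x t). norm g \<le> (B + L) / \<beta>)"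
    using AE
  proof (eventually_elim, intro impI)
    fix t assume *: "t0 < t \<longrightarrow> (\<exists>g\<in>subdifferential \<phi> (x t).
      (x has_vector_derivative ?u t - \<beta> *\<^sub>R g) (at t) \<and>
      (y has_vector_derivative ?d t *\<^sub>R x t - (1 / \<beta>) *\<^sub>R y t) (at t))" and t: "t \<in> {a<..<b'}"
    have "t0 < t" using t \<open>t0 < a\<close> by simp
    then obtain g where g: "g \<in> subdifferential \<phi> (x t)" "(x has_vector_derivative ?u t - \<beta> *\<^sub>R g) (at t)"
      using * by blast
    have "norm (?u t - \<beta> *\<^sub>R g) \<le> L" by (rule has_vector_derivative_norm_le_lipschitz[OF g(2) L t])
    moreover have "norm (?u t) \<le> B" using B t by simp
    ultimately have "norm (\<beta> *\<^sub>R g) \<le> B + L"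
      using norm_triangle_ineq4[of "?u t" "?u t - \<beta> *\<^sub>R g"] by simp
    then have "norm g \<le> (B + L) / \<beta>" using \<open>\<beta> > 0\<close> by (simp add: pos_le_divide_eq mult.commute)
    then show "\<exists>g\<in>subdifferential \<phi> (x t). norm g \<le> (B + L) / \<beta>" using g(1) by blast
  qed
  note * = bounded_subgradients_imp_lipschitz_composition[OF assms(1,2) ab(1) L this]
  show "\<forall>t\<in>{a..b}. \<phi> (x t) \<noteq> \<infinity>" using *(1) ab by auto
  show "abs_continuous_on {a..b} (\<lambda>t. real_of_ereal (\<phi> (x t)))"
    using abs_continuous_on_lipschitz[OF *(2)] by (rule abs_continuous_on_subset) (use ab in auto)
qed

text \<open>Elimination of \<open>y\<close>: the summand
  \<open>\<alpha> * \<beta> / t\<^sup>2\<close> of the second equation, divided by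
  \<open>\<beta>\<close>, cancels the derivative of the coefficient
  \<open>- \<alpha> / t\<close>.\<close>

lemma second_order_has_vector_derivative:
  fixes x y :: "real \<Rightarrow> 'a::real_normed_vector"
  assumes "t > 0" "\<beta> \<noteq> 0"
    and x: "(x has_vector_derivative (1 / \<beta> - \<alpha> / t) *\<^sub>R x t - (1 / \<beta>) *\<^sub>R y t - \<beta> *\<^sub>R g) (at t)"
    and y: "(y has_vector_derivative (1 / \<beta> - \<alpha> / t + \<alpha> * \<beta> / t\<^sup>2) *\<^sub>R x t - (1 / \<beta>) *\<^sub>R y t) (at t)"
  shows "((\<lambda>t. (1 / \<beta> - \<alpha> / t) *\<^sub>R x t - (1 / \<beta>) *\<^sub>R y t) has_vector_derivative
      - (\<alpha> / t) *\<^sub>R ((1 / \<beta> - \<alpha> / t) *\<^sub>R x t - (1 / \<beta>) *\<^sub>R y t - \<beta> *\<^sub>R g) - g) (at t)"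
proof -
  let ?c = "1 / \<beta> - \<alpha> / t"
  let ?x' = "?c *\<^sub>R x t - (1 / \<beta>) *\<^sub>R y t - \<beta> *\<^sub>R g"
    and ?y' = "(?c + \<alpha> * \<beta> / t\<^sup>2) *\<^sub>R x t - (1 / \<beta>) *\<^sub>R y t"
  have c: "((\<lambda>t. 1 / \<beta> - \<alpha> / t) has_real_derivative \<alpha> / t\<^sup>2) (at t)"
    using \<open>t > 0\<close> by (auto intro!: derivative_eq_intros simp: power2_eq_square)
  have "((\<lambda>t. (1 / \<beta> - \<alpha> / t) *\<^sub>R x t - (1 / \<beta>) *\<^sub>R y t) has_vector_derivative
      (?c *\<^sub>R ?x' + (\<alpha> / t\<^sup>2) *\<^sub>R x t) - (1 / \<beta>) *\<^sub>R ?y') (at t)"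
    by (intro has_vector_derivative_diff has_vector_derivative_scaleR c x
        bounded_linear.has_vector_derivative[OF bounded_linear_scaleR_right y])
  moreover have "(?c *\<^sub>R ?x' + (\<alpha> / t\<^sup>2) *\<^sub>R x t) - (1 / \<beta>) *\<^sub>R ?y' = - (\<alpha> / t) *\<^sub>R ?x' - g"
  proof -
    have "(1 / \<beta>) *\<^sub>R ?y' = (1 / \<beta>) *\<^sub>R (?x' + \<beta> *\<^sub>R g) + (\<alpha> / t\<^sup>2) *\<^sub>R x t"
      using \<open>\<beta> \<noteq> 0\<close> by (simp add: algebra_simps)
    moreover have "?c *\<^sub>R ?x' = (1 / \<beta>) *\<^sub>R ?x' - (\<alpha> / t) *\<^sub>R ?x'" by (simp only: scaleR_diff_left)
    moreover have "(1 / \<beta>) *\<^sub>R (?x' + \<beta> *\<^sub>R g) = (1 / \<beta>) *\<^sub>R ?x' + g"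
      using \<open>\<beta> \<noteq> 0\<close> by (simp only: scaleR_add_right) simp
    ultimately show ?thesis by (simp only: scaleR_minus_left) simp
  qed
  ultimately show ?thesis by simp
qed

theorem theorem4p12:
  fixes \<phi> :: "'h::{real_inner, complete_space} \<Rightarrow> ereal"
    and \<alpha> \<beta> t0 :: real
    and x y :: "real \<Rightarrow> 'h"
    and x0 y0 :: 'h
  assumes "proper \<phi>" and "lower_semicontinuous \<phi>" and "ereal_convex \<phi>"
    and "argmin \<phi> \<noteq> {}"
    and "\<alpha> > 3" and "\<beta> > 0" and "t0 > 0"
    and "x0 \<in> edom \<phi>"
    and "global_strong_solution \<phi> \<alpha> \<beta> t0 x y"
    and "x t0 = x0" and "y t0 = y0"
  shows "(\<forall>\<^sub>F t in at_top. x t \<in> edom \<phi>) \<and>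
         (\<lambda>t. real_of_ereal (\<phi> (x t) - min_value \<phi>)) \<in> o(\<lambda>t. 1 / t\<^sup>2) \<and>
         (\<forall>\<xi>. subgradient_selection \<phi> \<alpha> \<beta> t0 x y \<xi> \<longrightarrow>
            (\<lambda>t. norm (vector_derivative x (at t) + \<beta> *\<^sub>R \<xi> t)) \<in> o[ae_at_top](\<lambda>t. 1 / t))"
proof -
  note sol = assms(9)
  obtain z where "z \<in> argmin \<phi>" using assms(4) by blast
  then have z: "\<phi> z \<le> \<phi> w" for w by (simp add: argmin_def is_arg_min_linorder)
  have min_value: "min_value \<phi> = \<phi> z" unfolding min_value_def
    by (rule antisym) (auto intro: INF_lower INF_greatest z)
  obtain w where "\<phi> w \<noteq> \<infinity>" using assms(1) unfolding proper_def by blast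
  then have z_fin: "\<phi> z \<noteq> \<infinity>" "\<phi> z \<noteq> -\<infinity>"
    using z[of w] assms(1) unfolding proper_def by auto
  \<comment> \<open>By the first equation this equals \<open>x' + \<beta> \<xi>\<close> almost
    everywhere, whichever selection \<open>\<xi>\<close> is taken, yet it is defined at every time
    and absolutely continuous on compact intervals beyond \<open>t0\<close>.\<close>
  define u where "u t = (1 / \<beta> - \<alpha> / t) *\<^sub>R x t - (1 / \<beta>) *\<^sub>R y t" for t
  define f where "f t = real_of_ereal (\<phi> (x t)) - real_of_ereal (\<phi> z)" for t
  have fin: "\<phi> (x t) \<noteq> \<infinity>" if "t0 < t" for t
    using global_strong_solution_regularity(1)[OF assms(1,2,6,7) sol that, of t] by simp
  have f_eq: "real_of_ereal (\<phi> (x t) - min_value \<phi>) = f t" if "t0 < t" for t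
    using fin[OF that] z_fin assms(1) unfolding min_value f_def proper_def
    by (cases "\<phi> (x t)"; cases "\<phi> z") auto
  have f_nonneg: "0 \<le> f t" if "t0 < t" for t
    using z[of "x t"] fin[OF that] z_fin assms(1) unfolding f_def proper_def
    by (cases "\<phi> (x t)"; cases "\<phi> z") auto
  have AC: "abs_continuous_on {a..b} x" "abs_continuous_on {a..b} u" "abs_continuous_on {a..b} f"
    if "t0 < a" for a b
  proof -
    note xy = global_strong_solution_abs_continuous_on[OF sol that, of b]
    show "abs_continuous_on {a..b} x" by (rule xy)
    have "abs_continuous_on {a..b} (\<lambda>t. 1 / \<beta> - \<alpha> / t)"
      using that assms(7) by (intro abs_continuous_on_C1[where f' = "\<lambda>t. \<alpha> / t\<^sup>2"])
        (auto intro!: derivative_eq_intros continuous_intros simp: power2_eq_square)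
    from abs_continuous_on_scaleR[OF this xy(1)]
    show "abs_continuous_on {a..b} u" unfolding u_def
      by (intro abs_continuous_on_diff abs_continuous_on_scaleR[OF abs_continuous_on_const xy(2)]) auto
    show "abs_continuous_on {a..b} f" unfolding f_def
      by (intro abs_continuous_on_diff abs_continuous_on_const
          global_strong_solution_regularity(2)[OF assms(1,2,6,7) sol that])
  qed
  have "AE t in lebesgue. t > t0 \<longrightarrow> (\<exists>\<xi>. (x has_vector_derivative u t - \<beta> *\<^sub>R \<xi>) (at t) \<and>
      (u has_vector_derivative - (\<alpha> / t) *\<^sub>R (u t - \<beta> *\<^sub>R \<xi>) - \<xi>) (at t) \<and>
      f t \<le> \<xi> \<bullet> (x t - z) \<and> (\<forall>s>t0. f t + \<xi> \<bullet> (x s - x t) \<le> f s))"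
    using global_strong_solution_AE[OF sol]
  proof (eventually_elim, intro impI)
    fix t assume *: "t0 < t \<longrightarrow> (\<exists>g\<in>subdifferential \<phi> (x t).
      (x has_vector_derivative (1 / \<beta> - \<alpha> / t) *\<^sub>R x t - (1 / \<beta>) *\<^sub>R y t - \<beta> *\<^sub>R g) (at t) \<and>
      (y has_vector_derivative (1 / \<beta> - \<alpha> / t + \<alpha> * \<beta> / t\<^sup>2) *\<^sub>R x t - (1 / \<beta>) *\<^sub>R y t) (at t))"
      and "t0 < t"
    then obtain g where g: "g \<in> subdifferential \<phi> (x t)"
      and x: "(x has_vector_derivative (1 / \<beta> - \<alpha> / t) *\<^sub>R x t - (1 / \<beta>) *\<^sub>R y t - \<beta> *\<^sub>R g) (at t)"
      and y: "(y has_vector_derivative (1 / \<beta> - \<alpha> / t + \<alpha> * \<beta> / t\<^sup>2) *\<^sub>R x t - (1 / \<beta>) *\<^sub>R y t) (at t)"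
      by blast
    have "t > 0" "\<beta> \<noteq> 0" using \<open>t0 < t\<close> assms by auto
    then have "(u has_vector_derivative - (\<alpha> / t) *\<^sub>R (u t - \<beta> *\<^sub>R g) - g) (at t)"
      using second_order_has_vector_derivative[OF _ _ x y] unfolding u_def by blast
    moreover have "f t \<le> g \<bullet> (x t - z)"
      using subgradient_inequality[OF assms(1) g z_fin(1)] by (simp add: f_def inner_diff_right)
    moreover have "f t + g \<bullet> (x s - x t) \<le> f s" if "t0 < s" for s
      using subgradient_inequality[OF assms(1) g fin[OF that]] by (simp add: f_def)
    ultimately show "\<exists>\<xi>. (x has_vector_derivative u t - \<beta> *\<^sub>R \<xi>) (at t) \<and>
      (u has_vector_derivative - (\<alpha> / t) *\<^sub>R (u t - \<beta> *\<^sub>R \<xi>) - \<xi>) (at t) \<and>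
      f t \<le> \<xi> \<bullet> (x t - z) \<and> (\<forall>s>t0. f t + \<xi> \<bullet> (x s - x t) \<le> f s)"
      using x unfolding u_def[of t] by blast
  qed
  note energy = energy_zero_tendsto_zero[OF assms(5-7) AC f_nonneg this]
  \<comment> \<open>Nonnegativity of \<open>f\<close> is known strictly after \<open>t0\<close>,
    hence the closed half-line starts at \<open>t0 + 1\<close>.\<close>
  note lims = energy_zero_asymptotics[OF energy, of "t0 + 1"]
  have f_lim: "((\<lambda>t. t\<^sup>2 * f t) \<longlongrightarrow> 0) at_top" using lims(1) f_nonneg by simp
  have u_lim: "((\<lambda>t. t * norm (u t)) \<longlongrightarrow> 0) at_top" using lims(2) f_nonneg by simp
  have "\<forall>\<^sub>F t in at_top. x t \<in> edom \<phi>"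
    using eventually_gt_at_top[of t0] by eventually_elim (simp add: edom_def fin)
  moreover have "(\<lambda>t. real_of_ereal (\<phi> (x t) - min_value \<phi>)) \<in> o(\<lambda>t. 1 / t\<^sup>2)"
  proof -
    have small: "f \<in> o(\<lambda>t. 1 / t\<^sup>2)"
      using f_lim by (intro smalloI_tendsto) (auto simp: mult.commute eventually_gt_at_top
          intro: eventually_mono[OF eventually_gt_at_top[of 0]])
    have eq: "\<forall>\<^sub>F t in at_top. real_of_ereal (\<phi> (x t) - min_value \<phi>) = f t"
      using eventually_gt_at_top[of t0] by eventually_elim (rule f_eq)
    show ?thesis unfolding landau_o.small.in_cong[OF eq] by (rule small)
  qed
  moreover have "(\<lambda>t. norm (vector_derivative x (at t) + \<beta> *\<^sub>R \<xi> t)) \<in> o[ae_at_top](\<lambda>t. 1 / t)"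
    if \<xi>: "subgradient_selection \<phi> \<alpha> \<beta> t0 x y \<xi>" for \<xi>
  proof -
    have "(\<lambda>t. norm (u t)) \<in> o(\<lambda>t. 1 / t)"
      using u_lim by (intro smalloI_tendsto) (auto simp: mult.commute
          intro: eventually_mono[OF eventually_gt_at_top[of 0]])
    \<comment> \<open>The bound on \<open>u\<close> holds at all large times and passes to the
      smaller filter \<open>ae_at_top\<close>.\<close>
    then have small: "(\<lambda>t. norm (u t)) \<in> o[ae_at_top](\<lambda>t. 1 / t)"
      by (rule landau_o.small.filter_mono[rotated]) (simp add: ae_at_top_def)
    have eq: "\<forall>\<^sub>F t in ae_at_top. norm (vector_derivative x (at t) + \<beta> *\<^sub>R \<xi> t) = norm (u t)"
      unfolding eventually_ae_at_top
    proof
      have "AE t in lebesgue. t > t0 \<longrightarrow> (\<exists>x'. (x has_vector_derivative x') (at t) \<and>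
          x' + \<beta> *\<^sub>R \<xi> t - (1 / \<beta> - \<alpha> / t) *\<^sub>R x t + (1 / \<beta>) *\<^sub>R y t = 0)"
        using \<xi> unfolding subgradient_selection_def by blast
      then show "AE t in lebesgue. t \<ge> t0 + 1 \<longrightarrow> norm (vector_derivative x (at t) + \<beta> *\<^sub>R \<xi> t) = norm (u t)"
      proof (eventually_elim, intro impI)
        fix t assume *: "t > t0 \<longrightarrow> (\<exists>x'. (x has_vector_derivative x') (at t) \<and>
          x' + \<beta> *\<^sub>R \<xi> t - (1 / \<beta> - \<alpha> / t) *\<^sub>R x t + (1 / \<beta>) *\<^sub>R y t = 0)" and "t \<ge> t0 + 1"
        then obtain x' where x': "(x has_vector_derivative x') (at t)"
            "x' + \<beta> *\<^sub>R \<xi> t - (1 / \<beta> - \<alpha> / t) *\<^sub>R x t + (1 / \<beta>) *\<^sub>R y t = 0" by auto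
        have "x' + \<beta> *\<^sub>R \<xi> t - u t = 0"
          unfolding u_def x'(2)[symmetric] by (simp only: diff_diff_eq2 diff_add_eq)
        then show "norm (vector_derivative x (at t) + \<beta> *\<^sub>R \<xi> t) = norm (u t)"
          using vector_derivative_at[OF x'(1)] by simp
      qed
    qed
    show ?thesis unfolding landau_o.small.in_cong[OF eq] by (rule small)
  qed
  ultimately show ?thesis by blast
qed

end
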